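(* Let ${\bf d}=(d_1,\ldots,d_n)$ be a degree sequence with all $d_i\ge 1$, and let ${\mathcal G}({\bf d})$ be the uniformly random simple graph on $[n]$ with degree sequence ${\bf d}$. Let $n_j=|\{i:d_i=j\}|$, $M_1=\sum_i d_i$, $\Delta=\max_i d_i$, $d=M_1/n$. Suppose there are constants $R_1>0$, $R_2>0$ and $0<\epsilon<1$ such that, with $\alpha_2=1/(R_2+4)$ and $\alpha_1=(1-\alpha_2)/(R_1+4)$, \begin{itemize} \item $\frac{\Delta^2}{d}=o\big(n^{\frac16-\frac{1}{2R_1}-\frac{1}{R_2}}\big)$, $\frac{\Delta^2}{d}=o\Big(\frac{n^{1/4}}{n_1^{1/2}}\Big)$, and $\frac{\Delta^2}{d}=o\Big(\frac{n^{\alpha_2/2}}{n_2^{\alpha_2/2}}\Big)$; \item $\left(\frac{n_i}{n}\right)^{\alpha_i(1-\epsilon)}\left(\frac{\Delta^2}{d}\right)^{2-\epsilon}=o(1)$ for $i\in\{1,2\}$. \end{itemize} Then ${\mathcal G}({\bf d})$ is asymptotically almost surely asymmetric.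
   Context: Degree sequences are graphical with even sum. A graph is asymmetric if its automorphism group is trivial. Asymptotics are as $n\to\infty$ (over a sequence of degree sequences); "asymptotically almost surely" means with probability tending to $1$; $a_n=o(b_n)$ means $a_n/b_n\to0$. *)

theory Defs
  imports "HOL-Probability.Probability_Mass_Function" "HOL-Combinatorics.Permutations"
begin

(* A finite simple graph on a fixed vertex set V is identified with its edge set,
   a set of two-element subsets of V. *)
definition simple_graph :: "'a set \<Rightarrow> 'a set set \<Rightarrow> bool" where
  "simple_graph V E \<longleftrightarrow> finite V \<and> E \<subseteq> {e. e \<subseteq> V \<and> card e = 2}"

definition degree :: "'a set set \<Rightarrow> 'a \<Rightarrow> nat" where
  "degree E v = card {e \<in> E. v \<in> e}"

(* "permutes V" fixes every point outside V, so each automorphism of (V, E) is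
   represented by exactly one function on the whole type, the trivial one by id. *)
definition automorphisms :: "'a set \<Rightarrow> 'a set set \<Rightarrow> ('a \<Rightarrow> 'a) set" where
  "automorphisms V E =
     {\<pi>. \<pi> permutes V \<and> (\<forall>u\<in>V. \<forall>v\<in>V. {u, v} \<in> E \<longleftrightarrow> {\<pi> u, \<pi> v} \<in> E)}"

definition asymmetric :: "'a set \<Rightarrow> 'a set set \<Rightarrow> bool" where
  "asymmetric V E \<longleftrightarrow> automorphisms V E = {id}"

(* A sequence (d 1, ..., d n) is a function of which only the values on {1..n} matter. *)
definition graphs_with_degrees :: "nat \<Rightarrow> (nat \<Rightarrow> nat) \<Rightarrow> nat set set set" where
  "graphs_with_degrees n d =
     {E. simple_graph {1..n} E \<and> (\<forall>i\<in>{1..n}. degree E i = d i)}"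

definition graphical :: "nat \<Rightarrow> (nat \<Rightarrow> nat) \<Rightarrow> bool" where
  "graphical n d \<longleftrightarrow> graphs_with_degrees n d \<noteq> {}"

(* M_1, the sum of the degrees *)
definition degree_sum :: "nat \<Rightarrow> (nat \<Rightarrow> nat) \<Rightarrow> nat" where
  "degree_sum n d = (\<Sum>i=1..n. d i)"

(* Evenness of the sum already follows from graphicality. *)
definition degree_sequence :: "nat \<Rightarrow> (nat \<Rightarrow> nat) \<Rightarrow> bool" where
  "degree_sequence n d \<longleftrightarrow> graphical n d \<and> even (degree_sum n d)"

(* n_j *)
definition num_degree :: "nat \<Rightarrow> (nat \<Rightarrow> nat) \<Rightarrow> nat \<Rightarrow> nat" where
  "num_degree n d j = card {i \<in> {1..n}. d i = j}"

definition max_degree :: "nat \<Rightarrow> (nat \<Rightarrow> nat) \<Rightarrow> nat" where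
  "max_degree n d = Max (d ` {1..n})"

definition avg_degree :: "nat \<Rightarrow> (nat \<Rightarrow> nat) \<Rightarrow> real" where
  "avg_degree n d = real (degree_sum n d) / real n"

(* The quotient Delta^2 / d *)
definition degree_ratio :: "nat \<Rightarrow> (nat \<Rightarrow> nat) \<Rightarrow> real" where
  "degree_ratio n d = (real (max_degree n d))\<^sup>2 / avg_degree n d"

definition random_graph :: "nat \<Rightarrow> (nat \<Rightarrow> nat) \<Rightarrow> nat set set pmf" where
  "random_graph n d = pmf_of_set (graphs_with_degrees n d)"

(* a = o(b) as "a/b tends to 0".  This differs from the Landau symbol of
   HOL-Library.Landau_Symbols where b vanishes, and the difference is essential for
   bounds such as b = n^(1/4) / n_1^(1/2): if n_1 = 0, the bound is infinite and the
   condition is vacuous.  With x / 0 = 0 in HOL, the quotient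
   a / (n^(1/4) / 0) = a / 0 = 0 has the intended value, whereas the Landau symbol
   would demand a = 0. *)
definition little_o :: "(nat \<Rightarrow> real) \<Rightarrow> (nat \<Rightarrow> real) \<Rightarrow> bool" where
  "little_o a b \<longleftrightarrow> (\<lambda>k. a k / b k) \<longlonglongrightarrow> 0"

lemma finite_graphs_with_degrees: "finite (graphs_with_degrees n d)"
proof -
  have "graphs_with_degrees n d \<subseteq> Pow (Pow {1..n})"
    by (auto simp: graphs_with_degrees_def simple_graph_def)
  then show ?thesis
    by (rule finite_subset) simp
qed

lemma set_random_graph:
  assumes "graphical n d"
  shows "set_pmf (random_graph n d) = graphs_with_degrees n d"
  using assms finite_graphs_with_degrees[of n d]
  by (simp add: random_graph_def graphical_def)

end

theory Submission
  imports Defs "HOL-Combinatorics.Cycles"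
begin

text \<open>
  Write \<open>\<rho> = \<Delta>\<^sup>2/d\<close> and \<open>q = L/n\<close> with \<open>L = 12e\<rho>\<close>. Switchings show that a fixed set \<open>F\<close> of pairs is
  contained in the random graph with probability at most \<open>q\<close> to the power \<open>|F|\<close>, for every \<open>F\<close>
  without restriction on its size. A graph that is not asymmetric has an automorphism \<open>\<pi>\<close> of prime
  order \<open>p\<close>, moving a set \<open>A\<close> of \<open>a = pc\<close> vertices. The edges meeting \<open>A\<close> form a union of orbits of
  \<open>\<pi>\<close>, and all orbits have size \<open>p\<close> except at most \<open>a\<close> fixed pairs. Weighting each edge by
  \<open>x \<ge> 1\<close> for every endpoint in \<open>A\<close> enforces the degree conditions: the probability that \<open>\<pi>\<close> is an
  automorphism is at most the product of \<open>1 + (weight of o)\<close> over all orbits \<open>o\<close>, divided by the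
  product of \<open>x\<close> to the power \<open>min 3 (d v)\<close> over \<open>v \<in> A\<close>. With \<open>x\<^sup>2 = 1/(q Z)\<close> and \<open>Z\<close> the maximum of
  \<open>L\<close> and the \<open>p\<close>-th root of \<open>a\<close>, the first product is at most \<open>e\<close> to the power \<open>3a\<close>. Summing over
  all \<open>\<pi>\<close>, encoded by their cycle minima and the positions of the other elements of each cycle,
  gives at most \<open>(e\<^sup>4 \<eta>)\<close> to the power \<open>pc\<close>, where \<open>\<eta>\<close> is a sum of terms of the order of
  \<open>n\<^sub>1 \<rho> / \<surd>n\<close>, \<open>n\<^sub>2 \<rho>\<^sup>2 / n\<close>, \<open>\<rho>\<^sup>3 / \<surd>n\<close> and the square root of the last. The first three growth
  conditions make all of these tend to 0.
\<close>

section \<open>Subgraph probabilities by switching\<close>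

lemma simple_graphD:
  assumes "simple_graph V E"
  shows "finite V" "finite E" "{x, y} \<in> E \<Longrightarrow> x \<in> V \<and> y \<in> V \<and> x \<noteq> y"
proof -
  show "finite V" using assms by (simp add: simple_graph_def)
  show "finite E"
    using assms by (auto simp: simple_graph_def intro: finite_subset[of E "Pow V"])
  show "x \<in> V \<and> y \<in> V \<and> x \<noteq> y" if "{x, y} \<in> E"
    using assms that by (force simp: simple_graph_def)
qed

lemma simple_graph_edgeE:
  assumes "simple_graph V E" "e \<in> E"
  obtains u v where "e = {u, v}" "u \<noteq> v" "u \<in> V" "v \<in> V"
proof -
  have "card e = 2" "e \<subseteq> V" using assms by (auto simp: simple_graph_def)
  then show ?thesis using that by (auto simp: card_2_iff)
qed

lemma sum_degree:
  assumes "simple_graph V E"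
  shows "(\<Sum>v\<in>V. degree E v) = 2 * card E"
  unfolding degree_def
proof (rule sum_multicount)
  show "finite V" "finite E" using simple_graphD[OF assms] by auto
  show "\<forall>e\<in>E. card {v \<in> V. v \<in> e} = 2"
  proof
    fix e assume "e \<in> E"
    then have "{v \<in> V. v \<in> e} = e" "card e = 2" using assms by (auto simp: simple_graph_def)
    then show "card {v \<in> V. v \<in> e} = 2" by simp
  qed
qed

lemma card_neighbours:
  assumes "simple_graph V E"
  shows "card {y. {x, y} \<in> E} = degree E x"
  unfolding degree_def
proof (rule bij_betw_same_card[of "\<lambda>y. {x, y}"], rule bij_betwI')
  show "\<exists>y\<in>{y. {x, y} \<in> E}. e = {x, y}" if "e \<in> {e \<in> E. x \<in> e}" for e
  proof -
    have "e \<in> E" using that by simp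
    then obtain u v where "e = {u, v}" by (rule simple_graph_edgeE[OF assms])
    then show ?thesis using that by (auto simp: insert_commute)
  qed
qed (auto simp: doubleton_eq_iff)

lemma finite_neighbours:
  assumes "simple_graph V E"
  shows "finite {y. {x, y} \<in> E}"
  using simple_graphD[OF assms] by (auto intro: finite_subset[of _ V])

text \<open>A switching depends on an orientation of the second edge, so edges are counted as
  ordered pairs, each edge twice.\<close>

lemma card_arcs:
  assumes "simple_graph V E"
  shows "card {(x, y). {x, y} \<in> E} = 2 * card E" and "finite {(x, y). {x, y} \<in> E}"
proof -
  note D = simple_graphD[OF assms]
  have eq: "{(x, y). {x, y} \<in> E} = (SIGMA x:V. {y. {x, y} \<in> E})" using D by auto
  show "finite {(x, y). {x, y} \<in> E}"
    unfolding eq using D finite_neighbours[OF assms] by (intro finite_SigmaI) auto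
  show "card {(x, y). {x, y} \<in> E} = 2 * card E"
    unfolding eq sum_degree[OF assms, symmetric]
    using D finite_neighbours[OF assms] by (subst card_SigmaI) (auto simp: card_neighbours[OF assms])
qed

lemma simple_graph_subset: "simple_graph V E \<Longrightarrow> F \<subseteq> E \<Longrightarrow> simple_graph V F"
  by (auto simp: simple_graph_def)

lemma degree_insert:
  "finite E \<Longrightarrow> e \<notin> E \<Longrightarrow> degree (insert e E) w = degree E w + of_bool (w \<in> e)"
proof -
  assume fin: "finite E" and e: "e \<notin> E"
  have "{f \<in> insert e E. w \<in> f} = (if w \<in> e then insert e {f \<in> E. w \<in> f} else {f \<in> E. w \<in> f})"
    by auto
  then show ?thesis using fin e by (simp add: degree_def)
qed

section \<open>Degree-preserving switchings\<close>

text \<open>The usual 2-switch. The order of \<open>x\<close> and \<open>y\<close> selects one of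
  the two ways to re-pair the four endpoints.\<close>

definition switch :: "'a \<Rightarrow> 'a \<Rightarrow> 'a set set \<Rightarrow> 'a \<Rightarrow> 'a \<Rightarrow> 'a set set" where
  "switch u v G x y = insert {u, x} (insert {v, y} (G - {{u, v}, {x, y}}))"

text \<open>The four vertices are distinct, and both graphs arise from the same remainder
  \<open>H\<close> by adding a perfect matching on them.\<close>

lemma degree_switch:
  assumes "finite G" "{u, v} \<in> G" "{x, y} \<in> G" "{u, x} \<notin> G" "{v, y} \<notin> G"
    and "u \<noteq> v" "x \<noteq> y" "x \<notin> {u, v}" "y \<notin> {u, v}"
  shows "degree (switch u v G x y) w = degree G w"
proof -
  define H where "H = G - {{u, v}, {x, y}}"
  have fin: "finite H" using assms by (simp add: H_def)
  have ne: "{u, v} \<noteq> {x, y}" "{u, x} \<noteq> {v, y}" using assms by (auto simp: doubleton_eq_iff)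
  have G: "G = insert {u, v} (insert {x, y} H)" using assms by (auto simp: H_def)
  have "degree G w = degree H w + of_bool (w \<in> {x, y}) + of_bool (w \<in> {u, v})"
    unfolding G using fin ne by (subst degree_insert degree_insert, simp, simp add: H_def)+ simp
  moreover have "degree (switch u v G x y) w
      = degree H w + of_bool (w \<in> {v, y}) + of_bool (w \<in> {u, x})"
    unfolding switch_def H_def[symmetric] using fin ne assms
    by (subst degree_insert degree_insert, simp, simp add: H_def)+ simp
  ultimately show ?thesis using assms by auto
qed

lemma simple_graph_switch:
  assumes "simple_graph V G" "{u, v} \<in> G" "{x, y} \<in> G" "x \<noteq> u" "y \<noteq> v"
  shows "simple_graph V (switch u v G x y)"
proof -
  have "u \<in> V" "v \<in> V" "x \<in> V" "y \<in> V" using simple_graphD(3)[OF assms(1)] assms by blast+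
  then show ?thesis using assms by (auto simp: simple_graph_def switch_def)
qed

text \<open>For fixed \<open>u\<close> and \<open>v\<close>, the switched graph together with
  \<open>(x, y)\<close> determines \<open>G\<close>. This gives injectivity in the double
  count.\<close>

lemma switch_inverse:
  assumes "{u, v} \<in> G" "{x, y} \<in> G" "{u, x} \<notin> G" "{v, y} \<notin> G"
    and "u \<noteq> v" "x \<noteq> y" "x \<notin> {u, v}" "y \<notin> {u, v}"
  shows "G = insert {u, v} (insert {x, y} (switch u v G x y - {{u, x}, {v, y}}))"
  using assms unfolding switch_def by (auto simp: doubleton_eq_iff)

definition containing :: "nat \<Rightarrow> (nat \<Rightarrow> nat) \<Rightarrow> nat set set \<Rightarrow> nat set set set" where
  "containing n d F = {G \<in> graphs_with_degrees n d. F \<subseteq> G}"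

lemma finite_containing: "finite (containing n d F)"
  unfolding containing_def using finite_graphs_with_degrees by auto

lemma graphs_with_degreesD:
  assumes "G \<in> graphs_with_degrees n d"
  shows "simple_graph {1..n} G" "finite G" "i \<in> {1..n} \<Longrightarrow> degree G i = d i"
    "degree_sum n d = 2 * card G" "degree G v \<le> max_degree n d"
proof -
  show sg: "simple_graph {1..n} G" using assms by (simp add: graphs_with_degrees_def)
  then show "finite G" using simple_graphD by blast
  show deg: "degree G i = d i" if "i \<in> {1..n}" for i
    using assms that by (simp add: graphs_with_degrees_def)
  show "degree_sum n d = 2 * card G"
    unfolding sum_degree[OF sg, symmetric] degree_sum_def by (simp add: deg)
  show "degree G v \<le> max_degree n d"
  proof (cases "v \<in> {1..n}")
    case True
    then show ?thesis unfolding deg[OF True] max_degree_def by (intro Max_ge) auto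
  next
    case False
    have "v \<notin> e" if "e \<in> G" for e using sg that False unfolding simple_graph_def by blast
    then have "{e \<in> G. v \<in> e} = {}" by blast
    then show ?thesis by (simp add: degree_def del: Collect_empty_eq)
  qed
qed

text \<open>Among the \<open>2 * (card G - card F - 1)\<close> arcs off \<open>F\<close> and
  \<open>{u, v}\<close>, a bad one starts in the closed neighbourhood of \<open>u\<close> or ends in
  that of \<open>v\<close>. Each kind has at most \<open>(D + 1) * D\<close> members, and
  \<open>D \<ge> 1\<close> absorbs the lower-order terms into \<open>6 * D\<^sup>2\<close>.\<close>

lemma card_switchings:
  assumes G: "G \<in> graphs_with_degrees n d" and F: "insert {u, v} F \<subseteq> G" "{u, v} \<notin> F"
    and D: "D = max_degree n d"
  defines "W \<equiv> {(x, y). {x, y} \<in> G - insert {u, v} F \<and> x \<noteq> u \<and> y \<noteq> v \<and> {u, x} \<notin> G \<and> {v, y} \<notin> G}"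
  shows "2 * (card G - card F) \<le> card W + 6 * D\<^sup>2" and "finite W"
proof -
  note GD = graphs_with_degreesD[OF G]
  let ?A = "{(x, y). {x, y} \<in> G - insert {u, v} F}"
  let ?N = "\<lambda>w. insert w {x. {w, x} \<in> G}"
  let ?B1 = "SIGMA x:?N u. {y. {x, y} \<in> G}"
  let ?B2 = "SIGMA y:?N v. {x. {y, x} \<in> G}"
  have sg: "simple_graph {1..n} (G - insert {u, v} F)"
    using GD(1) by (rule simple_graph_subset) auto
  have finF: "finite F" using F GD(2) finite_subset by auto
  have cN: "card (?N w) \<le> D + 1" for w
    using card_insert_le_m1[of "D + 1" "{x. {w, x} \<in> G}" w] GD(5)[of w]
      card_neighbours[OF GD(1), of w] D by simp
  have fN: "finite (?N w)" for w using finite_neighbours[OF GD(1)] by simp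
  have B: "card (SIGMA x:?N w. {y. {x, y} \<in> G}) \<le> (D + 1) * D" for w
  proof -
    have "card (SIGMA x:?N w. {y. {x, y} \<in> G}) = (\<Sum>x\<in>?N w. degree G x)"
      using fN finite_neighbours[OF GD(1)]
      by (subst card_SigmaI) (auto simp: card_neighbours[OF GD(1)])
    also have "\<dots> \<le> card (?N w) * D"
      using sum_bounded_above[of "?N w" "degree G" D] GD(5) D by simp
    also have "\<dots> \<le> (D + 1) * D" using cN by (rule mult_right_mono) simp
    finally show ?thesis .
  qed
  have fB: "finite (SIGMA x:?N w. {y. {x, y} \<in> G})" for w
    using fN finite_neighbours[OF GD(1)] by (intro finite_SigmaI) auto
  have WA: "W \<subseteq> ?A" unfolding W_def by auto
  show "finite W" using WA card_arcs(2)[OF sg] finite_subset by blast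
  have "?A \<subseteq> W \<union> (?B1 \<union> prod.swap ` ?B2)"
    unfolding W_def by (auto simp: image_iff insert_commute)
  then have "card ?A \<le> card (W \<union> (?B1 \<union> prod.swap ` ?B2))"
    using fB \<open>finite W\<close> by (intro card_mono) auto
  also have "\<dots> \<le> card W + (card ?B1 + card (prod.swap ` ?B2))"
    by (meson card_Un_le add_left_mono le_trans)
  also have "\<dots> \<le> card W + ((D + 1) * D + (D + 1) * D)"
    by (intro add_mono order_refl B order_trans[OF card_image_le[OF fB] B])
  finally have "card ?A \<le> card W + 2 * ((D + 1) * D)" by simp
  moreover have "card ?A = 2 * (card G - card F - 1)"
    unfolding card_arcs(1)[OF sg] using F finF GD(2) by (subst card_Diff_subset) auto
  moreover have "D \<ge> 1"
  proof -
    have "0 < degree G u" unfolding degree_def using F GD(2) by (auto simp: card_gt_0_iff)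
    then show ?thesis using GD(5)[of u] D by simp
  qed
  then have "D \<le> D\<^sup>2" "1 \<le> D\<^sup>2" by (simp_all add: self_le_power)
  then have "D\<^sup>2 + D + 1 \<le> 3 * D\<^sup>2" by linarith
  then have "(D + 1) * D + 1 \<le> 3 * D\<^sup>2" by (simp add: power2_eq_square)
  ultimately show "2 * (card G - card F) \<le> card W + 6 * D\<^sup>2" by linarith
qed

text \<open>
  The factor 6 (rather than 1) makes the bound trivial, by monotonicity, once \<open>m - |F|\<close> is at most
  \<open>6 \<Delta>\<^sup>2\<close>. Hence no upper bound on \<open>|F|\<close> is needed.
\<close>

lemma card_containing_insert:
  assumes e: "e \<notin> F" and m: "degree_sum n d = 2 * m"
  shows "card (containing n d (insert e F)) * (m - card F)
    \<le> 6 * (max_degree n d)\<^sup>2 * card (containing n d F)"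
proof -
  define D where "D = max_degree n d"
  define A where "A = containing n d (insert e F)"
  define C where "C = containing n d F"
  have fin: "finite A" "finite C" by (simp_all add: A_def C_def finite_containing)
  have AC: "A \<subseteq> C" by (auto simp: A_def C_def containing_def)
  have le: "card A \<le> card C" using AC fin by (simp add: card_mono)
  show ?thesis
  proof (cases "A = {} \<or> m - card F \<le> 6 * D\<^sup>2")
    case True
    then show ?thesis
    proof (rule disjE)
      assume "m - card F \<le> 6 * D\<^sup>2"
      then show ?thesis using mult_mono[OF le \<open>m - card F \<le> _\<close>] unfolding A_def C_def D_def by (simp add: mult.commute)
    qed (simp add: A_def)
  next
    case False
    then obtain G0 where "G0 \<in> A" by auto
    then have "simple_graph {1..n} G0" "e \<in> G0"
      using graphs_with_degreesD(1) unfolding A_def containing_def by blast+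
    then obtain u v where uv: "e = {u, v}" "u \<noteq> v" by (rule simple_graph_edgeE)
    define W where "W G = {(x, y). {x, y} \<in> G - insert {u, v} F \<and> x \<noteq> u \<and> y \<noteq> v \<and> {u, x} \<notin> G \<and> {v, y} \<notin> G}" for G
    have AD: "G \<in> graphs_with_degrees n d" "insert {u, v} F \<subseteq> G" "{u, v} \<notin> F" "{u, v} \<in> G" if "G \<in> A" for G
      using that e uv by (auto simp: A_def containing_def)
    \<comment> \<open>Outside the trivial case, subtracting \<open>6 * D\<^sup>2\<close> from
      \<open>2 * (m - card F)\<close> leaves at least \<open>m - card F\<close>.\<close>
    have Wc: "m - card F \<le> card (W G)" "finite (W G)" if "G \<in> A" for G
    proof -
      have "card G = m" using graphs_with_degreesD(4)[OF AD(1)[OF that]] m by simp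
      then show "m - card F \<le> card (W G)" "finite (W G)"
        using card_switchings[OF AD(1-3)[OF that] D_def] False unfolding W_def by auto
    qed
    \<comment> \<open>\<open>x = v\<close> and \<open>y = u\<close> are excluded because
      \<open>{u, x}\<close> or \<open>{v, y}\<close> would then be the edge
      \<open>{u, v}\<close>.\<close>
    have WD: "{x, y} \<in> G" "{x, y} \<notin> F" "{x, y} \<noteq> {u, v}" "{u, x} \<notin> G" "{v, y} \<notin> G" "x \<noteq> y" "x \<notin> {u, v}" "y \<notin> {u, v}"
      if "G \<in> A" "(x, y) \<in> W G" for G x y
      using that AD[OF that(1)] uv simple_graphD(3)[OF graphs_with_degreesD(1)[OF AD(1)[OF that(1)]], of x y]
      by (auto simp: W_def insert_commute)
    \<comment> \<open>Double counting of switchings. The switched graph still contains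
      \<open>F\<close>, since neither removed edge lies in \<open>F\<close>. In it \<open>x\<close>
      and \<open>y\<close> are neighbours of \<open>u\<close> and \<open>v\<close>, which leaves at
      most \<open>D\<^sup>2\<close> preimages per graph.\<close>
    let ?S = "SIGMA G:A. W G"
    let ?T = "SIGMA H:C. {x. {u, x} \<in> H} \<times> {y. {v, y} \<in> H}"
    let ?f = "\<lambda>(G, x, y). (switch u v G x y, x, y)"
    have "inj_on ?f ?S"
    proof (rule inj_onI)
      fix a b assume "a \<in> ?S" "b \<in> ?S" "?f a = ?f b"
      then obtain G G' x y where ab: "a = (G, x, y)" "b = (G', x, y)"
        and *: "G \<in> A" "(x, y) \<in> W G" "G' \<in> A" "(x, y) \<in> W G'"
        and sw: "switch u v G x y = switch u v G' x y" by auto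
      have "H = insert {u, v} (insert {x, y} (switch u v H x y - {{u, x}, {v, y}}))"
        if "H \<in> A" "(x, y) \<in> W H" for H
        using switch_inverse[of u v H x y] WD[OF that] AD[OF that(1)] uv by blast
      then have "G = G'" using * sw by metis
      then show "a = b" using ab by simp
    qed
    moreover have "?f ` ?S \<subseteq> ?T"
    proof
      fix b assume "b \<in> ?f ` ?S"
      then obtain G x y where b: "b = (switch u v G x y, x, y)" and *: "G \<in> A" "(x, y) \<in> W G"
        by auto
      note w = WD[OF *] and a = AD[OF *(1)] and g = graphs_with_degreesD[OF AD(1)[OF *(1)]]
      have "simple_graph {1..n} (switch u v G x y)"
        using w a g by (intro simple_graph_switch) auto
      moreover have "degree (switch u v G x y) i = degree G i" for i
        using w a uv g(2) by (intro degree_switch) auto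
      moreover have "F \<subseteq> switch u v G x y" using w a by (auto simp: switch_def)
      ultimately have "switch u v G x y \<in> C"
        using g(3) by (auto simp: C_def containing_def graphs_with_degrees_def)
      then show "b \<in> ?T" by (simp add: b switch_def)
    qed
    moreover have finT: "finite ?T"
      using fin finite_neighbours[OF graphs_with_degreesD(1)]
      by (intro finite_SigmaI finite_cartesian_product) (auto simp: C_def containing_def)
    ultimately have "card ?S \<le> card ?T" by (rule card_inj_on_le)
    also have "card ?T = (\<Sum>H\<in>C. card ({x. {u, x} \<in> H} \<times> {y. {v, y} \<in> H}))"
      using fin finite_neighbours[OF graphs_with_degreesD(1)]
      by (intro card_SigmaI ballI finite_cartesian_product) (auto simp: C_def containing_def)
    also have "\<dots> \<le> (\<Sum>H\<in>C. D * D)"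
    proof (rule sum_mono)
      fix H assume "H \<in> C"
      then have H: "H \<in> graphs_with_degrees n d" by (simp add: C_def containing_def)
      show "card ({x. {u, x} \<in> H} \<times> {y. {v, y} \<in> H}) \<le> D * D"
        unfolding card_cartesian_product card_neighbours[OF graphs_with_degreesD(1)[OF H]] D_def
        using graphs_with_degreesD(5)[OF H] by (intro mult_mono) auto
    qed
    finally have "card ?S \<le> D\<^sup>2 * card C" by (simp add: power2_eq_square mult.commute)
    moreover have "card ?S = (\<Sum>G\<in>A. card (W G))" using fin Wc by simp
    moreover have "card A * (m - card F) \<le> (\<Sum>G\<in>A. card (W G))"
      using sum_bounded_below[of A "m - card F" "\<lambda>G. card (W G)"] Wc by simp
    ultimately show ?thesis unfolding A_def C_def D_def by linarith
  qed
qed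


section \<open>From single edges to arbitrary edge sets\<close>

text \<open>Induction on \<open>t\<close>: for \<open>m = k + 1\<close> and
  \<open>t \<le> k\<close>, \<open>(1 + 1 / k) ^ t \<le> exp (t / k) \<le> exp 1\<close>, so passing
  from \<open>m\<close> to \<open>k\<close> costs one factor \<open>exp 1\<close>.\<close>

lemma power_le_exp_mult_falling:
  "t \<le> m \<Longrightarrow> real m ^ t \<le> exp 1 ^ t * (\<Prod>j<t. real (m - j))"
proof (induction t arbitrary: m)
  case (Suc t)
  then obtain k where m: "m = Suc k" "t \<le> k" by (cases m) auto
  have "real m ^ t \<le> exp 1 * real k ^ t"
  proof (cases "k = 0")
    case False
    have "(1 + 1 / real k) ^ t \<le> exp (1 / real k) ^ t"
      by (intro power_mono) auto
    also have "\<dots> = exp (real t / real k)" by (simp add: exp_of_nat_mult[symmetric])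
    also have "\<dots> \<le> exp 1" using m False by simp
    finally have "(1 + 1 / real k) ^ t * real k ^ t \<le> exp 1 * real k ^ t"
      by (rule mult_right_mono) simp
    also have "(1 + 1 / real k) ^ t * real k ^ t = real m ^ t"
      using False m by (simp add: power_mult_distrib[symmetric] field_simps)
    finally show ?thesis .
  qed (use m in auto)
  also have "\<dots> \<le> exp 1 * (exp 1 ^ t * (\<Prod>j<t. real (k - j)))"
    using Suc.IH[OF m(2)] by simp
  finally have "real m * real m ^ t \<le> real m * (exp 1 * (exp 1 ^ t * (\<Prod>j<t. real (k - j))))"
    by (rule mult_left_mono) simp
  then show ?case using m by (simp add: prod.lessThan_Suc_shift mult_ac del: prod.lessThan_Suc)
qed simp

text \<open>The edges of \<open>F\<close> are added one at a time, and the factors build up a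
  falling factorial. For \<open>card F > m\<close> truncated subtraction makes the product
  zero.\<close>

lemma card_containing_falling:
  assumes m: "degree_sum n d = 2 * m" and "finite F"
  shows "card (containing n d F) * (\<Prod>j<card F. m - j)
    \<le> (6 * (max_degree n d)\<^sup>2) ^ card F * card (graphs_with_degrees n d)"
  using \<open>finite F\<close>
proof (induction F)
  case empty
  then show ?case by (simp add: containing_def)
next
  case (insert e F)
  let ?c = "6 * (max_degree n d)\<^sup>2"
  have "card (containing n d (insert e F)) * (\<Prod>j<card (insert e F). m - j)
      = (card (containing n d (insert e F)) * (m - card F)) * (\<Prod>j<card F. m - j)"
    using insert by simp
  also have "\<dots> \<le> ?c * card (containing n d F) * (\<Prod>j<card F. m - j)"
    by (intro mult_right_mono card_containing_insert insert m) simp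
  also have "\<dots> \<le> ?c * (?c ^ card F * card (graphs_with_degrees n d))"
    using insert.IH by (metis mult.assoc mult_le_mono2)
  finally show ?case using insert by (simp add: mult.assoc)
qed

lemma card_containing_le:
  assumes M: "even (degree_sum n d)" and "finite F"
  shows "real (card (containing n d F)) \<le>
    (12 * exp 1 * (real (max_degree n d))\<^sup>2 / real (degree_sum n d)) ^ card F
      * real (card (graphs_with_degrees n d))"
proof -
  obtain m where m: "degree_sum n d = 2 * m" using M by blast
  let ?t = "card F" and ?N = "real (card (containing n d F))" and ?g = "real (card (graphs_with_degrees n d))"
  show ?thesis
  proof (cases "?N = 0 \<or> ?t = 0")
    case True
    then show ?thesis
    proof
      assume "?N = 0"
      then show ?thesis by simp
    next
      assume "?t = 0"
      then show ?thesis using \<open>finite F\<close> by (simp add: containing_def)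
    qed
  next
    case False
    then have "containing n d F \<noteq> {}" by auto
    then obtain G where G: "G \<in> graphs_with_degrees n d" "F \<subseteq> G"
      unfolding containing_def by blast
    \<comment> \<open>Some graph contains \<open>F\<close> in this case, so
      \<open>card F \<le> m\<close> and the falling factorial is at least
      \<open>(m / exp 1) ^ card F\<close>.\<close>
    have tm: "?t \<le> m" using card_mono[OF graphs_with_degreesD(2)[OF G(1)] G(2)]
        graphs_with_degreesD(4)[OF G(1)] m by simp
    with False have m0: "m > 0" by simp
    have "?N * real m ^ ?t \<le> exp 1 ^ ?t * (?N * (\<Prod>j<?t. real (m - j)))"
      using mult_left_mono[OF power_le_exp_mult_falling[OF tm], of ?N] by (simp add: mult_ac)
    also have "?N * (\<Prod>j<?t. real (m - j)) \<le> (6 * (real (max_degree n d))\<^sup>2) ^ ?t * ?g"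
      using of_nat_mono[OF card_containing_falling[OF m \<open>finite F\<close>], where ?'a = real] by simp
    finally have "?N * real m ^ ?t \<le> (exp 1 * (6 * (real (max_degree n d))\<^sup>2)) ^ ?t * ?g"
      by (simp add: power_mult_distrib mult_ac)
    then have "?N \<le> (exp 1 * (6 * (real (max_degree n d))\<^sup>2)) ^ ?t * ?g / real m ^ ?t"
      using m0 by (simp add: field_simps)
    also have "\<dots> = (exp 1 * (6 * (real (max_degree n d))\<^sup>2) / real m) ^ ?t * ?g"
      by (simp add: power_divide)
    \<comment> \<open>The degree sum is \<open>2 * m\<close>, which turns 6 into 12.\<close>
    also have "exp 1 * (6 * (real (max_degree n d))\<^sup>2) / real m
        = 12 * exp 1 * (real (max_degree n d))\<^sup>2 / real (degree_sum n d)"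
      using m m0 by (simp add: field_simps)
    finally show ?thesis .
  qed
qed

section \<open>Invariant edge sets of a permutation of prime order\<close>

text \<open>The orbit of \<open>x\<close> when \<open>f ^^ p = id\<close>, taken both for vertices
  under \<open>\<pi>\<close> and for pairs under \<open>image \<pi>\<close>.\<close>

definition cyc :: "('b \<Rightarrow> 'b) \<Rightarrow> nat \<Rightarrow> 'b \<Rightarrow> 'b set" where
  "cyc f p x = (\<lambda>i. (f ^^ i) x) ` {..<p}"

lemma funpow_mod_order:
  assumes "f ^^ p = id"
  shows "f ^^ (i mod p) = f ^^ i"
proof -
  have "f ^^ (p * k) = id" for k
    by (induction k) (simp_all add: funpow_add assms)
  then have "f ^^ (i mod p + p * (i div p)) = f ^^ (i mod p)"
    by (subst funpow_add) simp
  then show ?thesis by simp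
qed

lemma cyc_eq_range:
  assumes "f ^^ p = id" "p > 0"
  shows "cyc f p x = range (\<lambda>i. (f ^^ i) x)"
proof -
  have "(f ^^ i) x \<in> cyc f p x" for i
    unfolding cyc_def using assms by (intro image_eqI[of _ _ "i mod p"]) (auto simp: funpow_mod_order)
  then show ?thesis by (auto simp: cyc_def)
qed

lemma finite_cyc: "finite (cyc f p x)"
  by (simp add: cyc_def)

lemma cyc_self:
  assumes "f ^^ p = id" "p > 0"
  shows "x \<in> cyc f p x"
  unfolding cyc_eq_range[OF assms] by (rule image_eqI[of _ _ 0]) auto

lemma cyc_eq:
  assumes "f ^^ p = id" "p > 0" "y \<in> cyc f p x"
  shows "cyc f p y = cyc f p x"
proof -
  obtain i where y: "y = (f ^^ i) x" using assms by (auto simp: cyc_eq_range)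
  \<comment> \<open>\<open>f ^^ j\<close> undoes \<open>f ^^ i\<close>, because
    \<open>i + j = p * i\<close>.\<close>
  define j where "j = p * i - i"
  have "(f ^^ j) y = (f ^^ (p * i)) x"
    using \<open>p > 0\<close> by (simp add: y j_def funpow_add[symmetric, THEN fun_cong, simplified])
  also have "\<dots> = x" using funpow_mod_order[OF assms(1), of "p * i"] by simp
  finally have x: "x = (f ^^ j) y" by simp
  have "(f ^^ k) y \<in> cyc f p x" for k
    unfolding cyc_eq_range[OF assms(1,2)] y by (rule image_eqI[of _ _ "k + i"]) (simp_all add: funpow_add)
  moreover have "(f ^^ k) x \<in> cyc f p y" for k
    unfolding cyc_eq_range[OF assms(1,2)] by (subst x, rule image_eqI[of _ _ "k + j"]) (simp_all add: funpow_add)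
  ultimately show ?thesis unfolding cyc_eq_range[OF assms(1,2)] by blast
qed

text \<open>If two iterates below \<open>p\<close> coincide, some \<open>f ^^ k\<close> with
  \<open>0 < k < p\<close> fixes \<open>x\<close>. As \<open>k\<close> is coprime to
  \<open>p\<close>, Bezout makes \<open>x\<close> a fixed point of \<open>f\<close>.\<close>

lemma inj_on_funpow_prime:
  assumes p: "prime p" and id: "f ^^ p = id" and mv: "f x \<noteq> x"
  shows "inj_on (\<lambda>i. (f ^^ i) x) {..<p}"
proof -
  have False if ij: "i < j" "j < p" and eq: "(f ^^ i) x = (f ^^ j) x" for i j
  proof -
    define k where "k = j - i"
    have k: "0 < k" "k < p" using ij by (auto simp: k_def)
    have "(f ^^ (p - i + i)) x = (f ^^ (p - i + j)) x"
      by (simp only: funpow_add o_apply eq)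
    moreover have "p - i + j = p + k" "p - i + i = p" using ij by (auto simp: k_def)
    ultimately have fk: "(f ^^ k) x = x" by (simp add: funpow_add id)
    have "(f ^^ (k * a)) x = x" for a
      by (induction a) (simp_all add: funpow_add fk)
    moreover have "coprime k p"
      using p k by (metis coprime_commute nat_dvd_not_less prime_imp_coprime)
    then obtain a b where "k * a = p * b + 1"
      using bezout_nat[of k p] k by auto
    moreover have "f ^^ (p * b + 1) = f ^^ 1"
      using funpow_mod_order[OF id, of "p * b + 1"] prime_gt_1_nat[OF p]
      by (metis mod_mult_self4 mod_less)
    ultimately have "(f ^^ 1) x = x" by metis
    then show False using mv by simp
  qed
  then show ?thesis
    by (intro inj_onI) (metis lessThan_iff linorder_neqE_nat)
qed

lemma card_cyc:
  assumes "prime p" "f ^^ p = id" "f x \<noteq> x"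
  shows "card (cyc f p x) = p"
  unfolding cyc_def using inj_on_funpow_prime[OF assms] by (simp add: card_image)

text \<open>An invariant set is a disjoint union of orbits, so the sum is at most the product of
  \<open>1 + w K\<close> over all orbits \<open>K\<close>, and
  \<open>1 + t \<le> exp t\<close>.\<close>

lemma sum_invariant_prod_le_exp:
  fixes y :: "'b \<Rightarrow> real"
  assumes id: "f ^^ p = id" "p > 0" and X: "finite X" "\<And>e. e \<in> X \<Longrightarrow> f e \<in> X"
    and y: "\<And>e. e \<in> X \<Longrightarrow> y (f e) = y e" "\<And>e. e \<in> X \<Longrightarrow> y e \<ge> 0"
  shows "(\<Sum>E | E \<subseteq> X \<and> f ` E \<subseteq> E. \<Prod>e\<in>E. y e) \<le> exp (\<Sum>e\<in>X. y e ^ card (cyc f p e))"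
proof -
  let ?c = "cyc f p"
  define w where "w = (\<lambda>o'. \<Prod>e\<in>o'. y e)"
  have closed: "?c e \<subseteq> E" if "f ` E \<subseteq> E" "e \<in> E" for E e
  proof -
    have "(f ^^ i) e \<in> E" for i using that by (induction i) auto
    then show ?thesis by (auto simp: cyc_def)
  qed
  have cX: "?c e \<subseteq> X" if "e \<in> X" for e using closed[of X e] X that by auto
  have ycyc: "y e' = y e" if "e \<in> X" "e' \<in> ?c e" for e e'
  proof -
    have "(f ^^ i) e \<in> X \<and> y ((f ^^ i) e) = y e" for i
      using that by (induction i) (auto simp: X y)
    then show ?thesis using that by (auto simp: cyc_def)
  qed
  have wc: "w (?c e) = y e ^ card (?c e)" if "e \<in> X" for e
    unfolding w_def using ycyc[OF that] by simp
  have w0: "w K \<ge> 0" if "K \<in> ?c ` X" for K using that wc y(2) by auto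
  have un: "\<Union> (?c ` E) = E" if "f ` E \<subseteq> E" for E
    using closed[OF that] cyc_self[OF id] by auto
  have disj: "?c e \<inter> ?c e' = {}" if "?c e \<noteq> ?c e'" for e e'
    using that cyc_eq[OF id] by blast
  have "(\<Sum>E | E \<subseteq> X \<and> f ` E \<subseteq> E. \<Prod>e\<in>E. y e) = (\<Sum>E | E \<subseteq> X \<and> f ` E \<subseteq> E. \<Prod>K\<in>?c ` E. w K)"
  proof (rule sum.cong[OF refl])
    fix E assume E: "E \<in> {E. E \<subseteq> X \<and> f ` E \<subseteq> E}"
    have "(\<Prod>e\<in>E. y e) = (\<Prod>e\<in>\<Union> (?c ` E). y e)" using E un by simp
    also have "\<dots> = (\<Prod>K\<in>?c ` E. w K)"
      unfolding w_def using disj finite_cyc by (subst prod.Union_disjoint) (auto simp: o_def)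
    finally show "(\<Prod>e\<in>E. y e) = (\<Prod>K\<in>?c ` E. w K)" .
  qed
  \<comment> \<open>An invariant \<open>E\<close> is the union of its orbits, so different sets have
    different families of orbits.\<close>
  also have "\<dots> = (\<Sum>S\<in>(\<lambda>E. ?c ` E) ` {E. E \<subseteq> X \<and> f ` E \<subseteq> E}. \<Prod>K\<in>S. w K)"
    by (subst sum.reindex) (auto intro!: inj_onI, (metis un)+)
  also have "\<dots> \<le> (\<Sum>S\<in>Pow (?c ` X). \<Prod>K\<in>S. w K)"
    using X w0 by (intro sum_mono2) (auto intro!: prod_nonneg)
  also have "\<dots> = (\<Prod>K\<in>?c ` X. w K + 1)"
    using X by (subst prod_add) auto
  also have "\<dots> \<le> (\<Prod>K\<in>?c ` X. exp (w K))"
    using w0 by (intro prod_mono) (auto simp: add.commute intro: exp_ge_add_one_self)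
  also have "\<dots> = exp (\<Sum>K\<in>?c ` X. w K)" using X by (simp add: exp_sum)
  \<comment> \<open>An orbit is now counted once per element, which only increases the sum.\<close>
  also have "(\<Sum>K\<in>?c ` X. w K) \<le> (\<Sum>e\<in>X. w (?c e))"
    using sum_image_le[of X w ?c] X w0 by (simp add: o_def)
  also have "\<dots> = (\<Sum>e\<in>X. y e ^ card (?c e))" using wc by simp
  finally show ?thesis by simp
qed

section \<open>Weights of the orbits of pairs\<close>

lemma sum_degree_inter:
  assumes "finite A" "finite E"
  shows "(\<Sum>v\<in>A. degree E v) = (\<Sum>e\<in>E. card (e \<inter> A))"
  unfolding degree_def
  by (rule sum_multicount_gen) (use assms in \<open>auto simp: Int_def conj_commute\<close>)

lemma funpow_image: "(image f ^^ i) e = (f ^^ i) ` e" for f :: "'a \<Rightarrow> 'a"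
  by (induction i) (auto simp: image_image)

text \<open>The image of \<open>u\<close> is the second point of the pair. Hence there are at most
  as many fixed pairs meeting \<open>A\<close> as moved vertices, and they lie inside
  \<open>A\<close>.\<close>

lemma fixed_pairE:
  assumes "inj \<pi>" "card e = 2" "\<pi> ` e = e" "u \<in> e" "\<pi> u \<noteq> u"
  shows "e = {u, \<pi> u}" "\<pi> (\<pi> u) \<noteq> \<pi> u"
proof -
  have "\<pi> u \<in> e" using assms by blast
  moreover have "finite e" using assms card_ge_0_finite by force
  ultimately show "e = {u, \<pi> u}"
    using assms by (intro card_seteq[symmetric]) auto
  show "\<pi> (\<pi> u) \<noteq> \<pi> u" using assms by (auto dest: injD)
qed

text \<open>Three classes contribute at most \<open>card A\<close> each, one for each bound in
  \<open>z\<close>. There are at most \<open>card A\<close> fixed pairs, of weight at most 1. Other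
  pairs have orbits of size \<open>p\<close>: at most \<open>(card A)\<^sup>2\<close> of them lie
  inside \<open>A\<close>, with weight \<open>(q * x\<^sup>2) ^ p\<close>, and at most
  \<open>card A * card V\<close> have one point in \<open>A\<close>, with weight
  \<open>(q * x) ^ p\<close>.\<close>

lemma sum_weights_le:
  fixes x q :: real and V :: "'a set"
  defines "X \<equiv> \<lambda>A. {e. e \<subseteq> V \<and> card e = 2 \<and> e \<inter> A \<noteq> {}}"
  assumes V: "finite V" and \<pi>: "\<pi> permutes V" and p: "prime p" "\<pi> ^^ p = id"
    and A: "A = {v. \<pi> v \<noteq> v}"
    and x: "x \<ge> 1" and q: "q \<ge> 0" and z: "q * x\<^sup>2 \<le> 1" "card A * (q * x\<^sup>2) ^ p \<le> 1"
      "card V * (q * (q * x\<^sup>2)) \<le> 1"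
  shows "(\<Sum>e\<in>X A. (q * x ^ card (e \<inter> A)) ^ card (cyc (image \<pi>) p e)) \<le> 3 * card A"
proof -
  let ?z = "q * x\<^sup>2" and ?a = "real (card A)"
  let ?w = "\<lambda>e. (q * x ^ card (e \<inter> A)) ^ card (cyc (image \<pi>) p e)"
  have AV: "A \<subseteq> V" using \<pi> by (auto simp: A permutes_def)
  have finA: "finite A" using AV V finite_subset by auto
  have inj: "inj \<pi>" using \<pi> permutes_inj by auto
  have z0: "?z \<ge> 0" using q by simp
  have idp: "image \<pi> ^^ p = id" by (auto simp: funpow_image p fun_eq_iff)
  have p2: "p \<ge> 2" using p prime_ge_2_nat by auto
  have finX: "finite (X A)" unfolding X_def using V by (auto intro: finite_subset[of _ "Pow V"])
  define X1 X2 X3 where "X1 = {e \<in> X A. \<pi> ` e = e}"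
    and "X2 = {e \<in> X A. \<pi> ` e \<noteq> e \<and> e \<subseteq> A}"
    and "X3 = {e \<in> X A. \<pi> ` e \<noteq> e \<and> \<not> e \<subseteq> A}"
  have fins: "finite X1" "finite X2" "finite X3" unfolding X1_def X2_def X3_def using finX by auto
  have split: "X A = X1 \<union> (X2 \<union> X3)" "X1 \<inter> (X2 \<union> X3) = {}" "X2 \<inter> X3 = {}"
    by (auto simp: X1_def X2_def X3_def)

  have "X1 \<subseteq> (\<lambda>u. {u, \<pi> u}) ` A"
  proof
    fix e assume "e \<in> X1"
    then obtain u where u: "u \<in> e" "u \<in> A" "card e = 2" "\<pi> ` e = e" by (auto simp: X1_def X_def)
    then show "e \<in> (\<lambda>u. {u, \<pi> u}) ` A" using fixed_pairE(1)[OF inj u(3,4,1)] by (auto simp: A)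
  qed
  then have c1: "card X1 \<le> card A" by (rule surj_card_le[OF finA])
  have w1: "?w e \<le> 1" if "e \<in> X1" for e
  proof -
    have "e \<inter> A \<noteq> {}" using that by (auto simp: X1_def X_def)
    then obtain u where u: "u \<in> e" "u \<in> A" by auto
    have e: "card e = 2" "\<pi> ` e = e" using that by (auto simp: X1_def X_def)
    have "e = {u, \<pi> u}" "\<pi> (\<pi> u) \<noteq> \<pi> u" using fixed_pairE[OF inj e u(1)] u by (auto simp: A)
    then have "e \<inter> A = e" using u by (auto simp: A)
    then have "?w e = ?z ^ card (cyc (image \<pi>) p e)" using e by simp
    also have "\<dots> \<le> 1" using z z0 by (intro power_le_one)
    finally show ?thesis .
  qed
  have c2: "card X2 \<le> card A * card A"
  proof -
    have "X2 \<subseteq> (\<lambda>(u, v). {u, v}) ` (A \<times> A)"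
      by (force simp: X2_def X_def card_2_iff)
    then show ?thesis using surj_card_le[of "A \<times> A" X2] finA by (simp add: card_cartesian_product)
  qed
  have w2: "?w e \<le> ?z ^ p" if "e \<in> X2" for e
  proof -
    have e: "card e = 2" "e \<inter> A = e" "\<pi> ` e \<noteq> e" using that by (auto simp: X2_def X_def)
    then have "card (cyc (image \<pi>) p e) = p" using card_cyc[OF p(1) idp, of e] by simp
    then show ?thesis using e by simp
  qed
  have e3: "\<exists>u v. e = {u, v} \<and> u \<in> A \<and> v \<in> V \<and> e \<inter> A = {u}" if e: "e \<in> X3" for e
  proof -
    obtain u where u: "u \<in> e" "u \<in> A" using e by (auto simp: X3_def X_def)
    obtain a b where "e = {a, b}" using e by (auto simp: X3_def X_def card_2_iff)
    then show ?thesis using u e by (auto simp: X3_def X_def)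
  qed
  have c3: "card X3 \<le> card A * card V"
  proof -
    have "X3 \<subseteq> (\<lambda>(u, v). {u, v}) ` (A \<times> V)" using e3 by force
    then show ?thesis using surj_card_le[of "A \<times> V" X3] finA V by (simp add: card_cartesian_product)
  qed
  have w3: "?w e \<le> q * ?z" if e: "e \<in> X3" for e
  proof -
    have "e \<inter> A \<noteq> e" "\<pi> ` e \<noteq> e" using e by (auto simp: X3_def)
    then have c: "card (cyc (image \<pi>) p e) = p" using card_cyc[OF p(1) idp, of e] by simp
    \<comment> \<open>This allows the exponent \<open>p\<close> to be lowered to 2, where the weight
      is \<open>q * (q * x\<^sup>2)\<close>.\<close>
    have qx: "q * x \<le> 1"
    proof -
      have "q * x \<le> q * x\<^sup>2" using x q by (intro mult_left_mono self_le_power) auto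
      then show ?thesis using z by simp
    qed
    obtain u where "e \<inter> A = {u}" using e3[OF e] by auto
    then have "?w e = (q * x) ^ p" using c by simp
    also have "\<dots> \<le> (q * x) ^ 2" using p2 qx q x by (intro power_decreasing) auto
    finally show ?thesis by (simp add: power2_eq_square mult_ac)
  qed
  have "sum ?w X1 \<le> ?a"
    using sum_bounded_above[of X1 ?w 1] w1 c1 by simp
  moreover have "sum ?w X2 \<le> ?a"
  proof -
    have "sum ?w X2 \<le> real (card X2) * ?z ^ p"
      using sum_bounded_above[of X2 ?w "?z ^ p"] w2 by simp
    also have "\<dots> \<le> real (card A * card A) * ?z ^ p"
      using c2 z0 by (intro mult_right_mono) (simp_all only: of_nat_le_iff zero_le_power)
    also have "\<dots> \<le> ?a" using mult_left_mono[OF z(2), of ?a] by (simp add: mult_ac)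
    finally show ?thesis .
  qed
  moreover have "sum ?w X3 \<le> ?a"
  proof -
    have "sum ?w X3 \<le> real (card X3) * (q * ?z)"
      using sum_bounded_above[of X3 ?w "q * ?z"] w3 by simp
    also have "\<dots> \<le> real (card A * card V) * (q * ?z)"
      using c3 z0 q by (intro mult_right_mono) (simp_all only: of_nat_le_iff zero_le_mult_iff, auto)
    also have "\<dots> \<le> ?a" using mult_left_mono[OF z(3), of ?a] by (simp add: mult_ac)
    finally show ?thesis .
  qed
  ultimately show ?thesis
    unfolding split(1) using fins split by (simp add: sum.union_disjoint)
qed

text \<open>A union bound over the set \<open>E\<close> of edges meeting \<open>A\<close>. As
  \<open>E\<close> has the prescribed degrees on \<open>A\<close> and \<open>x \<ge> 1\<close>, the
  product on the left is at most \<open>x\<close> to the sum of these degrees, which splits into a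
  factor \<open>x ^ card (e \<inter> A)\<close> per edge. After that only the invariance of
  \<open>E\<close> is kept.\<close>

lemma card_automorphic_le:
  fixes x q :: real and n :: nat
  defines "V \<equiv> {1..n}"
  assumes \<pi>: "\<pi> permutes V" and p: "prime p" "\<pi> ^^ p = id"
    and A: "A = {v. \<pi> v \<noteq> v}"
    and x: "x \<ge> 1" and q: "q \<ge> 0" and z: "q * x\<^sup>2 \<le> 1" "card A * (q * x\<^sup>2) ^ p \<le> 1"
      "n * (q * (q * x\<^sup>2)) \<le> 1"
    and sup: "\<And>F. finite F \<Longrightarrow> card (containing n d F) \<le> q ^ card F * card (graphs_with_degrees n d)"
  shows "card {G \<in> graphs_with_degrees n d. \<pi> \<in> automorphisms V G} * (\<Prod>v\<in>A. x ^ min 3 (d v))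
    \<le> exp 3 ^ card A * card (graphs_with_degrees n d)"
proof -
  let ?g = "card (graphs_with_degrees n d)"
  define X where "X = {e. e \<subseteq> V \<and> card e = 2 \<and> e \<inter> A \<noteq> {}}"
  define I where "I = {E. E \<subseteq> X \<and> image \<pi> ` E \<subseteq> E}"
  define J where "J = {E \<in> I. \<forall>v\<in>A. degree E v = d v}"
  define S where "S = {G \<in> graphs_with_degrees n d. \<pi> \<in> automorphisms V G}"
  have V: "finite V" "card V = n" by (auto simp: V_def)
  have AV: "A \<subseteq> V" using \<pi> by (auto simp: A permutes_def)
  have finA: "finite A" using AV V finite_subset by auto
  have inj: "inj \<pi>" using \<pi> permutes_inj by auto
  have idp: "image \<pi> ^^ p = id" by (auto simp: funpow_image p fun_eq_iff)
  have finX: "finite X" unfolding X_def using V by (auto intro: finite_subset[of _ "Pow V"])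
  have finI: "finite I" unfolding I_def using finX by (auto intro: finite_subset[of _ "Pow X"])
  have Afix: "\<pi> v \<in> A \<longleftrightarrow> v \<in> A" for v using inj by (auto simp: A dest: injD)
  \<comment> \<open>\<open>\<pi>\<close> permutes the moved points, so the weight of a pair is
    constant on its orbit.\<close>
  have eA: "card (\<pi> ` e \<inter> A) = card (e \<inter> A)" for e
  proof -
    have "\<pi> ` e \<inter> A = \<pi> ` (e \<inter> A)" using Afix by auto
    then show ?thesis using inj by (simp add: card_image inj_on_def)
  qed
  have X\<pi>: "\<pi> ` e \<in> X" if "e \<in> X" for e
    using that \<pi> inj Afix by (auto simp: X_def permutes_in_image card_image inj_on_subset)

  have finJ: "finite J" using finI by (simp add: J_def)
  \<comment> \<open>The witness is \<open>G \<inter> X\<close>: it is invariant and contains all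
    edges at every vertex of \<open>A\<close>.\<close>
  have "S \<subseteq> (\<Union>E\<in>J. containing n d E)"
  proof
    fix G assume G: "G \<in> S"
    then have G1: "G \<in> graphs_with_degrees n d" and aut: "\<pi> \<in> automorphisms V G" by (auto simp: S_def)
    note GD = graphs_with_degreesD[OF G1]
    have "\<pi> ` e \<in> G" if eG: "e \<in> G" for e
    proof -
      obtain u v where "e = {u, v}" "u \<in> V" "v \<in> V"
        unfolding V_def by (rule simple_graph_edgeE[OF GD(1) eG])
      then show ?thesis using aut that by (auto simp: automorphisms_def)
    qed
    then have I: "G \<inter> X \<in> I" using X\<pi> by (auto simp: I_def)
    have "degree (G \<inter> X) v = d v" if "v \<in> A" for v
    proof -
      have "{e \<in> G \<inter> X. v \<in> e} = {e \<in> G. v \<in> e}"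
        using GD(1) that unfolding simple_graph_def X_def V_def by blast
      then show ?thesis using GD(3)[of v] that AV by (auto simp: degree_def V_def)
    qed
    then have "G \<inter> X \<in> J" using I by (simp add: J_def)
    moreover have "G \<in> containing n d (G \<inter> X)" using G1 by (auto simp: containing_def)
    ultimately show "G \<in> (\<Union>E\<in>J. containing n d E)" by blast
  qed
  then have "card S \<le> (\<Sum>E\<in>J. card (containing n d E))"
    using card_mono[of "\<Union>E\<in>J. containing n d E" S] card_UN_le[OF finJ, of "containing n d"]
      finJ finite_containing by (meson finite_UN_I le_trans)
  then have "real (card S) * (\<Prod>v\<in>A. x ^ min 3 (d v))
      \<le> (\<Sum>E\<in>J. card (containing n d E)) * (\<Prod>v\<in>A. x ^ min 3 (d v))"
    using x by (intro mult_right_mono prod_nonneg) (simp_all only: of_nat_le_iff, auto)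
  also have "\<dots> = (\<Sum>E\<in>J. card (containing n d E) * (\<Prod>v\<in>A. x ^ min 3 (d v)))"
    by (simp add: sum_distrib_right)
  also have "\<dots> \<le> (\<Sum>E\<in>J. ?g * (\<Prod>e\<in>E. q * x ^ card (e \<inter> A)))"
  proof (rule sum_mono)
    fix E assume E: "E \<in> J"
    have finE: "finite E" using E finX finite_subset by (auto simp: J_def I_def)
    \<comment> \<open>The cap at 3 only lowers the left side; later estimates distinguish just the
      degrees 1, 2 and at least 3.\<close>
    have "(\<Prod>v\<in>A. x ^ min 3 (d v)) \<le> (\<Prod>v\<in>A. x ^ degree E v)"
      using E x by (intro prod_mono) (auto simp: J_def intro!: power_increasing)
    also have "\<dots> = x ^ (\<Sum>e\<in>E. card (e \<inter> A))"
      by (simp add: power_sum sum_degree_inter[OF finA finE, symmetric])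
    finally have "card (containing n d E) * (\<Prod>v\<in>A. x ^ min 3 (d v))
        \<le> (q ^ card E * ?g) * x ^ (\<Sum>e\<in>E. card (e \<inter> A))"
      using sup[OF finE] x q by (intro mult_mono prod_nonneg) auto
    also have "\<dots> = ?g * (\<Prod>e\<in>E. q * x ^ card (e \<inter> A))"
      by (simp add: prod.distrib power_sum)
    finally show "card (containing n d E) * (\<Prod>v\<in>A. x ^ min 3 (d v))
        \<le> ?g * (\<Prod>e\<in>E. q * x ^ card (e \<inter> A))" .
  qed
  \<comment> \<open>The degree conditions have produced their factor and are dropped; the added
    terms are nonnegative.\<close>
  also have "\<dots> \<le> (\<Sum>E\<in>I. ?g * (\<Prod>e\<in>E. q * x ^ card (e \<inter> A)))"
    using finI x q by (intro sum_mono2) (auto simp: J_def intro!: prod_nonneg mult_nonneg_nonneg)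
  also have "\<dots> = ?g * (\<Sum>E\<in>I. \<Prod>e\<in>E. q * x ^ card (e \<inter> A))"
    by (simp add: sum_distrib_left)
  finally have "real (card S) * (\<Prod>v\<in>A. x ^ min 3 (d v))
      \<le> ?g * (\<Sum>E\<in>I. \<Prod>e\<in>E. q * x ^ card (e \<inter> A))" .
  also have "\<dots> \<le> ?g * exp 3 ^ card A"
  proof (rule mult_left_mono)
    have "(\<Sum>E\<in>I. \<Prod>e\<in>E. q * x ^ card (e \<inter> A))
        \<le> exp (\<Sum>e\<in>X. (q * x ^ card (e \<inter> A)) ^ card (cyc (image \<pi>) p e))"
      unfolding I_def using finX X\<pi> eA x q idp prime_gt_0_nat[OF p(1)]
      by (intro sum_invariant_prod_le_exp) auto
    also have "\<dots> \<le> exp (3 * card A)"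
      unfolding X_def using sum_weights_le[OF V(1) \<pi> p A x q z(1,2)] z(3) V(2) by simp
    also have "\<dots> = exp 3 ^ card A"
      by (simp add: exp_of_nat_mult[symmetric] mult.commute)
    finally show "(\<Sum>E\<in>I. \<Prod>e\<in>E. q * x ^ card (e \<inter> A)) \<le> exp 3 ^ card A" .
  qed simp
  finally show ?thesis by (simp add: S_def mult.commute)
qed

section \<open>Summation over permutations of prime order\<close>

lemma sum_card_subsets_prod_le:
  fixes b :: "'a \<Rightarrow> real"
  assumes V: "finite V" and b: "\<And>v. v \<in> V \<Longrightarrow> b v \<ge> 0" and c: "c > 0"
  shows "(\<Sum>R | R \<subseteq> V \<and> card R = c. \<Prod>v\<in>R. b v) \<le> (exp 1 * sum b V / c) ^ c"
  \<comment> \<open>Expand the product of \<open>1 + t b v \<le> exp (t b v)\<close> and take \<open>t = c / sum b V\<close>.\<close>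
proof (cases "sum b V = 0")
  case True
  then have b0: "b v = 0" if "v \<in> V" for v using that V b sum_nonneg_eq_0_iff[of V b] by auto
  have "(\<Prod>v\<in>R. b v) = 0" if "R \<subseteq> V" "card R = c" for R
  proof -
    obtain v where "v \<in> R" using \<open>card R = c\<close> c by fastforce
    then show ?thesis using that V b0 finite_subset by (intro prod_zero) auto
  qed
  then show ?thesis using True c by simp
next
  case False
  define B where "B = sum b V"
  have B: "B > 0" using False sum_nonneg[of V b] b by (simp add: B_def less_le)
  define t where "t = c / B"
  have t: "t > 0" using c B by (simp add: t_def)
  have "t ^ c * (\<Sum>R | R \<subseteq> V \<and> card R = c. \<Prod>v\<in>R. b v)
      = (\<Sum>R | R \<subseteq> V \<and> card R = c. \<Prod>v\<in>R. t * b v)"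
    by (simp add: sum_distrib_left prod.distrib)
  also have "\<dots> \<le> (\<Sum>R\<in>Pow V. \<Prod>v\<in>R. t * b v)"
    using V b t by (intro sum_mono2) (auto intro!: prod_nonneg)
  also have "\<dots> = (\<Prod>v\<in>V. t * b v + 1)" using V by (subst prod_add) auto
  also have "\<dots> \<le> (\<Prod>v\<in>V. exp (t * b v))"
    using b t by (intro prod_mono) (auto simp: add.commute intro: exp_ge_add_one_self)
  also have "\<dots> = exp (t * B)" using V by (simp add: exp_sum B_def sum_distrib_left)
  also have "\<dots> = exp 1 ^ c" using B by (simp add: t_def exp_of_nat_mult[symmetric])
  finally have "(\<Sum>R | R \<subseteq> V \<and> card R = c. \<Prod>v\<in>R. b v) \<le> exp 1 ^ c / t ^ c"
    using t by (simp add: field_simps)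
  also have "\<dots> = (exp 1 * B / c) ^ c" by (simp add: t_def power_divide[symmetric])
  finally show ?thesis by (simp add: B_def)
qed

section \<open>Encoding permutations of prime order\<close>

text \<open>One representative per nontrivial cycle; taking the least makes the encoding
  canonical.\<close>

definition cycle_minima :: "('a::linorder \<Rightarrow> 'a) \<Rightarrow> nat \<Rightarrow> 'a set" where
  "cycle_minima \<pi> p = {v. \<pi> v \<noteq> v \<and> (\<forall>w\<in>cyc \<pi> p v. v \<le> w)}"

lemma cyc_moved:
  assumes "\<pi> ^^ p = id" "p > 0" "w \<in> cyc \<pi> p v" "\<pi> v \<noteq> v"
  shows "\<pi> w \<noteq> w"
proof
  assume "\<pi> w = w"
  then have "(\<pi> ^^ i) w = w" for i by (induction i) auto
  then have "cyc \<pi> p w \<subseteq> {w}" by (auto simp: cyc_def)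
  then have "v = w" using cyc_self[OF assms(1,2), of v] cyc_eq[OF assms(1-3)] by auto
  then show False using assms \<open>\<pi> w = w\<close> by simp
qed

text \<open>The orbit of a moved point has exactly \<open>p\<close> elements and one minimum, from
  which the point is reached after a unique number \<open>j < p\<close> of steps.\<close>

lemma bij_betw_cycle_minima:
  assumes p: "prime p" and id: "\<pi> ^^ p = id"
  shows "bij_betw (\<lambda>(r, j). (\<pi> ^^ j) r) (cycle_minima \<pi> p \<times> {..<p}) {v. \<pi> v \<noteq> v}"
proof (rule bij_betw_imageI)
  have p0: "p > 0" using p prime_gt_0_nat by auto
  have mem: "(\<pi> ^^ j) r \<in> cyc \<pi> p r" for j r by (simp add: cyc_eq_range[OF id p0])
  show "inj_on (\<lambda>(r, j). (\<pi> ^^ j) r) (cycle_minima \<pi> p \<times> {..<p})"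
  proof (rule inj_onI)
    fix a b assume "a \<in> cycle_minima \<pi> p \<times> {..<p}" "b \<in> cycle_minima \<pi> p \<times> {..<p}"
      and "(case a of (r, j) \<Rightarrow> (\<pi> ^^ j) r) = (case b of (r, j) \<Rightarrow> (\<pi> ^^ j) r)"
    then obtain r i s j where ab: "a = (r, i)" "b = (s, j)" and
      *: "r \<in> cycle_minima \<pi> p" "s \<in> cycle_minima \<pi> p" "i < p" "j < p" "(\<pi> ^^ i) r = (\<pi> ^^ j) s"
      by auto
    have "cyc \<pi> p r = cyc \<pi> p s"
      using cyc_eq[OF id p0 mem[of i r]] cyc_eq[OF id p0 mem[of j s]] * by simp
    then have "r \<in> cyc \<pi> p s" "s \<in> cyc \<pi> p r" using cyc_self[OF id p0] by blast+
    then have "r = s" using * by (auto simp: cycle_minima_def intro: antisym)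
    moreover from this have "i = j"
      using inj_onD[OF inj_on_funpow_prime[OF p id, of r], of i j] * by (auto simp: cycle_minima_def)
    ultimately show "a = b" using ab by simp
  qed
  show "(\<lambda>(r, j). (\<pi> ^^ j) r) ` (cycle_minima \<pi> p \<times> {..<p}) = {v. \<pi> v \<noteq> v}" (is "?f ` ?X = ?A")
  proof
    show "?f ` ?X \<subseteq> ?A" using cyc_moved[OF id p0 mem] by (auto simp: cycle_minima_def)
    show "?A \<subseteq> ?f ` ?X"
    proof
      fix v assume v: "v \<in> ?A"
      define r where "r = Min (cyc \<pi> p v)"
      have r: "r \<in> cyc \<pi> p v"
        unfolding r_def using finite_cyc cyc_self[OF id p0, of v] by (intro Min_in) auto
      then have eq: "cyc \<pi> p r = cyc \<pi> p v" by (rule cyc_eq[OF id p0])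
      have "r \<le> w" if "w \<in> cyc \<pi> p v" for w
        unfolding r_def using finite_cyc that by (rule Min_le)
      then have "r \<in> cycle_minima \<pi> p"
        unfolding cycle_minima_def using cyc_moved[OF id p0 r] v eq by auto
      moreover have "v \<in> cyc \<pi> p r" unfolding eq by (rule cyc_self[OF id p0])
      then obtain j where "j < p" "v = (\<pi> ^^ j) r" by (auto simp: cyc_def)
      ultimately show "v \<in> ?f ` ?X" by (intro image_eqI[of _ _ "(r, j)"]) auto
    qed
  qed
qed

lemma card_moved:
  assumes "prime p" "\<pi> ^^ p = id"
  shows "card {v. \<pi> v \<noteq> v} = card (cycle_minima \<pi> p) * p"
  using bij_betw_same_card[OF bij_betw_cycle_minima[OF assms]] by (simp add: card_cartesian_product)

text \<open>For prime \<open>p\<close>, \<open>c\<close> is the number of cycles of length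
  \<open>p\<close>.\<close>

definition prime_order_perms :: "'a set \<Rightarrow> nat \<Rightarrow> nat \<Rightarrow> ('a \<Rightarrow> 'a) set" where
  "prime_order_perms V p c = {\<pi>. \<pi> permutes V \<and> \<pi> ^^ p = id \<and> card {v. \<pi> v \<noteq> v} = p * c}"

lemma finite_prime_order_perms: "finite V \<Longrightarrow> finite (prime_order_perms V p c)"
  by (rule finite_subset[OF _ finite_permutations]) (auto simp: prime_order_perms_def)

text \<open>A permutation is determined by its set of cycle minima and the other elements of each
  cycle, listed by position. With these chosen freely in \<open>V\<close> the sum factors: each of
  the \<open>c * (p - 1)\<close> positions gives \<open>sum b V\<close>, while the minima form an
  unordered set, which gains \<open>(exp 1 / c) ^ c\<close>.\<close>

lemma sum_prime_order_perms_le: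
  fixes b :: "'a::linorder \<Rightarrow> real"
  assumes V: "finite V" and b: "\<And>v. v \<in> V \<Longrightarrow> b v \<ge> 0" and p: "prime p" and c: "c > 0"
  shows "(\<Sum>\<pi>\<in>prime_order_perms V p c. \<Prod>v | \<pi> v \<noteq> v. b v)
    \<le> (exp 1 * sum b V / c) ^ c * sum b V ^ (c * (p - 1))"
proof -
  let ?P = "prime_order_perms V p c"
  \<comment> \<open>Position 0 is the minimum itself, so only the positions from 1 to
    \<open>p - 1\<close> are recorded.\<close>
  define K where "K R = R \<times> {1..<p}" for R :: "'a set"
  define \<R> where "\<R> = {R. R \<subseteq> V \<and> card R = c}"
  define h where "h = (\<lambda>(R, F). (\<Prod>r\<in>R. b r) * (\<Prod>k\<in>K R. b (F k)))"
  define enc where "enc \<pi> = (cycle_minima \<pi> p, restrict (\<lambda>(r, j). (\<pi> ^^ j) r) (K (cycle_minima \<pi> p)))" for \<pi>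
  have p0: "p > 0" using p prime_gt_0_nat by auto
  have fin: "finite R" if "R \<in> \<R>" for R using that V finite_subset by (auto simp: \<R>_def)
  have fin\<R>: "finite \<R>" using V by (auto simp: \<R>_def intro: finite_subset[of _ "Pow V"])
  have PD: "\<pi> permutes V" "\<pi> ^^ p = id" "{v. \<pi> v \<noteq> v} \<subseteq> V" "cycle_minima \<pi> p \<in> \<R>" if "\<pi> \<in> ?P" for \<pi>
  proof -
    show 1: "\<pi> permutes V" "\<pi> ^^ p = id" using that by (auto simp: prime_order_perms_def)
    then show 2: "{v. \<pi> v \<noteq> v} \<subseteq> V" by (auto simp: permutes_def)
    have "card (cycle_minima \<pi> p) = c"
      using that card_moved[OF p 1(2)] p0 by (auto simp: prime_order_perms_def)
    then show "cycle_minima \<pi> p \<in> \<R>" using 2 by (auto simp: \<R>_def cycle_minima_def)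
  qed
  have "(\<Prod>v | \<pi> v \<noteq> v. b v) = h (enc \<pi>)" if \<pi>: "\<pi> \<in> ?P" for \<pi>
  proof -
    let ?R = "cycle_minima \<pi> p"
    have finR: "finite ?R" using PD(4)[OF \<pi>] fin by auto
    have un: "?R \<times> {..<p} = ?R \<times> {0} \<union> K ?R" using p0 by (auto simp: K_def)
    have "(\<Prod>v | \<pi> v \<noteq> v. b v) = (\<Prod>k\<in>?R \<times> {..<p}. b (case k of (r, j) \<Rightarrow> (\<pi> ^^ j) r))"
      by (rule prod.reindex_bij_betw[OF bij_betw_cycle_minima[OF p PD(2)[OF \<pi>]], symmetric])
    also have "\<dots> = (\<Prod>k\<in>?R \<times> {0}. b (case k of (r, j) \<Rightarrow> (\<pi> ^^ j) r))
        * (\<Prod>k\<in>K ?R. b (case k of (r, j) \<Rightarrow> (\<pi> ^^ j) r))"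
      unfolding un using finR by (intro prod.union_disjoint) (auto simp: K_def)
    also have "(\<Prod>k\<in>?R \<times> {0}. b (case k of (r, j) \<Rightarrow> (\<pi> ^^ j) r)) = (\<Prod>r\<in>?R. b r)"
      by (rule prod.reindex_bij_witness[of _ "\<lambda>r. (r, 0)" fst]) auto
    finally show ?thesis by (simp add: h_def enc_def)
  qed
  then have *: "(\<Sum>\<pi>\<in>?P. \<Prod>v | \<pi> v \<noteq> v. b v) = (\<Sum>\<pi>\<in>?P. h (enc \<pi>))"
    by (rule sum.cong[OF refl])
  have "inj_on enc ?P"
  proof (rule inj_onI)
    fix \<pi> \<sigma> assume P: "\<pi> \<in> ?P" "\<sigma> \<in> ?P" and eq: "enc \<pi> = enc \<sigma>"
    let ?R = "cycle_minima \<pi> p"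
    have R: "cycle_minima \<sigma> p = ?R" using eq by (simp add: enc_def)
    \<comment> \<open>\<open>j = p\<close> is included because the last element of a cycle is mapped
      back to \<open>r\<close>.\<close>
    have pow: "(\<pi> ^^ j) r = (\<sigma> ^^ j) r" if "r \<in> ?R" "j \<le> p" for r j
    proof (cases "j = 0 \<or> j = p")
      case True
      then show ?thesis using PD(2)[OF P(1)] PD(2)[OF P(2)] by auto
    next
      case False
      then have "(r, j) \<in> K ?R" using that by (auto simp: K_def)
      moreover have "snd (enc \<pi>) (r, j) = snd (enc \<sigma>) (r, j)" using eq by simp
      ultimately show ?thesis by (simp add: enc_def R)
    qed
    have moved: "{v. \<pi> v \<noteq> v} = {v. \<sigma> v \<noteq> v}"
    proof -
      have "(\<lambda>(r, j). (\<pi> ^^ j) r) ` (?R \<times> {..<p}) = (\<lambda>(r, j). (\<sigma> ^^ j) r) ` (?R \<times> {..<p})"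
        using pow by (intro image_cong) auto
      then show ?thesis
        using bij_betw_cycle_minima[OF p PD(2)[OF P(1)]] bij_betw_cycle_minima[OF p PD(2)[OF P(2)]]
        unfolding R bij_betw_def by simp
    qed
    show "\<pi> = \<sigma>"
    proof
      fix v
      show "\<pi> v = \<sigma> v"
      proof (cases "\<pi> v = v")
        case True
        then have "v \<notin> {v. \<sigma> v \<noteq> v}" unfolding moved[symmetric] by simp
        then show ?thesis using True by simp
      next
        case False
        then have "v \<in> (\<lambda>(r, j). (\<pi> ^^ j) r) ` (?R \<times> {..<p})"
          unfolding bij_betw_imp_surj_on[OF bij_betw_cycle_minima[OF p PD(2)[OF P(1)]]] by simp
        then obtain r j where rj: "r \<in> ?R" "j < p" "v = (\<pi> ^^ j) r" by auto
        then have "(\<pi> ^^ Suc j) r = (\<sigma> ^^ Suc j) r" "(\<pi> ^^ j) r = (\<sigma> ^^ j) r"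
          using pow[of r "Suc j"] pow[of r j] by auto
        then show ?thesis using rj by simp
      qed
    qed
  qed
  then have "(\<Sum>\<pi>\<in>?P. \<Prod>v | \<pi> v \<noteq> v. b v) = sum h (enc ` ?P)"
    unfolding * by (simp add: sum.reindex)
  \<comment> \<open>From actual codes to all pairs of a \<open>c\<close>-subset and an arbitrary
    function, over which the sum factors.\<close>
  also have "\<dots> \<le> sum h (SIGMA R:\<R>. K R \<rightarrow>\<^sub>E V)"
  proof (rule sum_mono2)
    show "finite (SIGMA R:\<R>. K R \<rightarrow>\<^sub>E V)"
      using fin fin\<R> V by (intro finite_SigmaI finite_PiE) (auto simp: K_def)
    have "(\<pi> ^^ j) r \<in> V" if "\<pi> \<in> ?P" "r \<in> cycle_minima \<pi> p" for \<pi> j r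
    proof -
      have "r \<in> V" using PD(4)[OF that(1)] that(2) by (auto simp: \<R>_def)
      then show ?thesis using permutes_in_image[OF PD(1)[OF that(1)]] by (induction j) auto
    qed
    then show "enc ` ?P \<subseteq> (SIGMA R:\<R>. K R \<rightarrow>\<^sub>E V)"
      using PD(4) by (auto simp: enc_def K_def split: if_splits)
    show "0 \<le> h k" if "k \<in> (SIGMA R:\<R>. K R \<rightarrow>\<^sub>E V) - enc ` ?P" for k
      using that b by (auto simp: h_def \<R>_def intro!: mult_nonneg_nonneg prod_nonneg dest: PiE_mem)
  qed
  also have "\<dots> = (\<Sum>R\<in>\<R>. \<Sum>F\<in>K R \<rightarrow>\<^sub>E V. (\<Prod>r\<in>R. b r) * (\<Prod>k\<in>K R. b (F k)))"
    unfolding h_def using fin\<R> fin V by (subst sum.Sigma) (auto simp: K_def intro!: finite_PiE)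
  also have "\<dots> = (\<Sum>R\<in>\<R>. (\<Prod>r\<in>R. b r) * sum b V ^ (c * (p - 1)))"
  proof (rule sum.cong[OF refl])
    fix R assume R: "R \<in> \<R>"
    have "(\<Sum>F\<in>K R \<rightarrow>\<^sub>E V. \<Prod>k\<in>K R. b (F k)) = (\<Prod>k\<in>K R. sum b V)"
      using fin[OF R] V by (intro prod_sum_PiE[symmetric]) (auto simp: K_def)
    also have "\<dots> = sum b V ^ (c * (p - 1))"
      using R by (simp add: K_def \<R>_def card_cartesian_product)
    finally show "(\<Sum>F\<in>K R \<rightarrow>\<^sub>E V. (\<Prod>r\<in>R. b r) * (\<Prod>k\<in>K R. b (F k)))
        = (\<Prod>r\<in>R. b r) * sum b V ^ (c * (p - 1))"
      by (simp add: sum_distrib_left[symmetric])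
  qed
  also have "\<dots> = (\<Sum>R\<in>\<R>. \<Prod>r\<in>R. b r) * sum b V ^ (c * (p - 1))"
    by (simp add: sum_distrib_right)
  also have "\<dots> \<le> (exp 1 * sum b V / c) ^ c * sum b V ^ (c * (p - 1))"
    unfolding \<R>_def using V b c
    by (intro mult_right_mono sum_card_subsets_prod_le zero_le_power sum_nonneg) auto
  finally show ?thesis .
qed

section \<open>Asymmetry\<close>

lemma automorphisms_comp:
  assumes "\<pi> \<in> automorphisms V E" "\<sigma> \<in> automorphisms V E"
  shows "\<pi> \<circ> \<sigma> \<in> automorphisms V E"
proof -
  have "\<sigma> u \<in> V" if "u \<in> V" for u
    using assms(2) that permutes_in_image by (fastforce simp: automorphisms_def)
  then show ?thesis using assms unfolding automorphisms_def by (simp add: permutes_compose)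
qed

lemma id_automorphism: "id \<in> automorphisms V E"
  by (simp add: automorphisms_def permutes_id)

lemma automorphisms_funpow: "\<pi> \<in> automorphisms V E \<Longrightarrow> \<pi> ^^ i \<in> automorphisms V E"
  by (induction i) (auto simp: id_automorphism automorphisms_comp)

text \<open>If \<open>N\<close> is the order of a nontrivial automorphism \<open>\<sigma>\<close>
  and \<open>p\<close> a prime divisor of \<open>N\<close>, take the power of
  \<open>\<sigma>\<close> with exponent \<open>N / p\<close>.\<close>

lemma prime_order_automorphism:
  assumes V: "finite V" and asym: "\<not> asymmetric V E"
  obtains \<pi> p where "\<pi> \<in> automorphisms V E" "prime p" "\<pi> ^^ p = id" "\<pi> \<noteq> id"
proof -
  obtain \<sigma> where \<sigma>: "\<sigma> \<in> automorphisms V E" "\<sigma> \<noteq> id"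
    using asym id_automorphism[of V E] unfolding asymmetric_def by blast
  then have "permutation \<sigma>"
    using V by (auto simp: automorphisms_def permutation_permutes)
  then obtain k where k: "\<sigma> ^^ k = id" "k > 0" by (rule permutation_is_nilpotent)
  define N where "N = (LEAST k. k > 0 \<and> \<sigma> ^^ k = id)"
  have N: "N > 0" "\<sigma> ^^ N = id" using LeastI[of "\<lambda>k. k > 0 \<and> \<sigma> ^^ k = id" k] k by (auto simp: N_def)
  have minimal: "\<sigma> ^^ i \<noteq> id" if "0 < i" "i < N" for i
    using not_less_Least[of i "\<lambda>k. k > 0 \<and> \<sigma> ^^ k = id"] that by (auto simp: N_def)
  have "N \<noteq> 1" using N \<sigma> by auto
  then obtain p where p: "prime p" "p dvd N" using prime_factor_nat by blast
  then obtain i where i: "N = i * p" by (metis dvd_def mult.commute)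
  have "0 < i" "i < N" using N(1) i prime_gt_1_nat[OF p(1)] by auto
  then have "\<sigma> ^^ i \<noteq> id" by (rule minimal)
  moreover have "(\<sigma> ^^ i) ^^ p = id" using N i by (simp add: funpow_mult mult.commute)
  ultimately show ?thesis using that automorphisms_funpow[OF \<sigma>(1)] p(1) by blast
qed

lemma not_asymmetric_subset:
  "{G \<in> graphs_with_degrees n d. \<not> asymmetric {1..n} G} \<subseteq>
    (\<Union>p\<in>{p. prime p \<and> p \<le> n}. \<Union>c\<in>{1..n div p}. \<Union>\<pi>\<in>prime_order_perms {1..n} p c.
      {G \<in> graphs_with_degrees n d. \<pi> \<in> automorphisms {1..n} G})"
proof
  fix G assume G: "G \<in> {G \<in> graphs_with_degrees n d. \<not> asymmetric {1..n} G}"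
  then obtain \<pi> p where \<pi>: "\<pi> \<in> automorphisms {1..n} G" "prime p" "\<pi> ^^ p = id" "\<pi> \<noteq> id"
    using prime_order_automorphism[of "{1..n}" G] by auto
  let ?A = "{v. \<pi> v \<noteq> v}"
  define c where "c = card (cycle_minima \<pi> p)"
  have perm: "\<pi> permutes {1..n}" using \<pi> by (simp add: automorphisms_def)
  then have sub: "?A \<subseteq> {1..n}" by (auto simp: permutes_def)
  then have fin: "finite ?A" using finite_subset by blast
  have cA: "card ?A = c * p" using card_moved[OF \<pi>(2,3)] by (simp add: c_def)
  have "card ?A \<noteq> 0" using \<pi>(4) fin by (auto simp: fun_eq_iff)
  then have c: "c \<ge> 1" using cA by (cases c) auto
  have le: "c * p \<le> n" using card_mono[OF _ sub] cA by simp
  have p0: "p > 0" using \<pi>(2) prime_gt_0_nat by auto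
  have "p \<le> n" using c le by (metis dual_order.trans mult_le_mono1 nat_mult_1)
  moreover have "c \<in> {1..n div p}" using c le p0 by (simp add: less_eq_div_iff_mult_less_eq)
  moreover have "\<pi> \<in> prime_order_perms {1..n} p c"
    using perm \<pi> cA by (simp add: prime_order_perms_def mult.commute)
  ultimately show "G \<in> (\<Union>p\<in>{p. prime p \<and> p \<le> n}. \<Union>c\<in>{1..n div p}. \<Union>\<pi>\<in>prime_order_perms {1..n} p c.
      {G \<in> graphs_with_degrees n d. \<pi> \<in> automorphisms {1..n} G})"
    using G \<pi> by blast
qed

text \<open>
  Here \<open>n1\<close>, \<open>n2\<close> stand for the numbers of vertices of degree 1 and 2, and \<open>L\<close> for \<open>12e\<Delta>\<^sup>2/d\<close>.
\<close>

definition error_term :: "real \<Rightarrow> real \<Rightarrow> real \<Rightarrow> real \<Rightarrow> real" where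
  "error_term n n1 n2 L = n1 * L / sqrt n + n2 * L\<^sup>2 / n + sqrt (L ^ 3 / sqrt n) + L ^ 3 / sqrt n"

section \<open>Choice of the weights and the union bound\<close>

text \<open>All degrees from 3 on contribute \<open>w ^ 3\<close>, which is simply charged to every
  vertex.\<close>

lemma sum_weights_by_degree:
  fixes w :: real
  assumes pos: "\<And>i. i \<in> {1..n} \<Longrightarrow> d i \<ge> 1" and w: "w \<ge> 0"
  shows "(\<Sum>v\<in>{1..n}. w ^ min 3 (d v))
    \<le> num_degree n d 1 * w + num_degree n d 2 * w\<^sup>2 + n * w ^ 3"
proof -
  have "(\<Sum>v\<in>{1..n}. w ^ min 3 (d v))
      \<le> (\<Sum>v\<in>{1..n}. (if d v = 1 then w else 0) + (if d v = 2 then w\<^sup>2 else 0) + w ^ 3)"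
  proof (rule sum_mono)
    fix v assume v: "v \<in> {1..n}"
    have "d v = 1 \<or> d v = 2 \<or> d v \<ge> 3" using pos[OF v] by linarith
    then show "w ^ min 3 (d v) \<le> (if d v = 1 then w else 0) + (if d v = 2 then w\<^sup>2 else 0) + w ^ 3"
      using w by auto
  qed
  also have "\<dots> = num_degree n d 1 * w + num_degree n d 2 * w\<^sup>2 + n * w ^ 3"
    by (simp add: sum.distrib num_degree_def sum.If_cases Int_def)
  finally show ?thesis .
qed

text \<open>Here \<open>w = 1 / x\<close> for the weight \<open>x\<close> per endpoint, with
  \<open>s\<close> in the role of the \<open>p\<close>-th root of \<open>a\<close>. The terms in
  \<open>n1\<close> and \<open>n2\<close> follow from \<open>max s L \<le> s * L\<close>. The cubic
  term uses \<open>s \<le> sqrt n\<close> if the maximum is \<open>s\<close>, and equals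
  \<open>L ^ 3 / sqrt n\<close> if it is \<open>L\<close>.\<close>

lemma weight_bounds:
  fixes n n1 n2 L s :: real
  assumes n: "n \<ge> 1" and n12: "n1 \<ge> 0" "n2 \<ge> 0" and L: "L \<ge> 1" and s: "1 \<le> s" "s \<le> sqrt n"
    and e: "error_term n n1 n2 L \<le> 1"
  defines "w \<equiv> sqrt (L / n * max s L)"
  shows "w > 0" "w \<le> 1" "n1 * w + n2 * w\<^sup>2 + n * w ^ 3 \<le> error_term n n1 n2 L * s"
proof -
  let ?r = "sqrt n"
  have r: "?r \<ge> 1" "?r * ?r = n" using n by auto
  have s0: "s > 0" "L > 0" "n > 0" using s L n by auto
  show "w > 0" unfolding w_def using s0 by (simp add: less_max_iff_disj)
  have w2: "w\<^sup>2 = L / n * max s L" unfolding w_def using s0 by (simp add: le_max_iff_disj)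
  \<comment> \<open>A single summand of the error term is at most 1. This gives
    \<open>L ^ 3 \<le> sqrt n\<close> and thereby \<open>w \<le> 1\<close>.\<close>
  have e3: "L ^ 3 / ?r \<le> 1"
    using e n12 s0 unfolding error_term_def
    by (smt (verit) divide_nonneg_nonneg mult_nonneg_nonneg real_sqrt_ge_zero zero_le_power zero_le_power2)
  then have L3: "L ^ 3 \<le> ?r" using r by (simp add: divide_le_eq)
  have LL: "L \<le> L ^ 3" "L\<^sup>2 \<le> L ^ 3" using L by (auto intro: self_le_power power_increasing)
  have "w\<^sup>2 \<le> 1"
  proof -
    have "L * max s L \<le> ?r * ?r"
      using LL L3 s s0 by (intro mult_mono) auto
    then show ?thesis using w2 r s0 by (simp add: divide_le_eq)
  qed
  then show "w \<le> 1" using \<open>w > 0\<close> by (simp add: power_le_one_iff abs_le_square_iff)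
  have w2s: "w\<^sup>2 \<le> s * (L\<^sup>2 / n)"
  proof -
    have "max s L \<le> s * L" using s L s0 by (simp add: mult_le_cancel_left1)
    then have "L / n * max s L \<le> L / n * (s * L)" using s0 by (intro mult_left_mono) auto
    then show ?thesis using w2 by (simp add: power2_eq_square mult_ac)
  qed
  have ws: "w \<le> s * (L / ?r)"
  proof (rule power2_le_imp_le)
    have "w\<^sup>2 \<le> s * (L\<^sup>2 / n)" by (rule w2s)
    also have "\<dots> \<le> s\<^sup>2 * (L\<^sup>2 / n)" using s s0 by (intro mult_right_mono self_le_power) auto
    also have "\<dots> = (s * (L / ?r))\<^sup>2" using s0 by (simp add: power_mult_distrib power_divide)
    finally show "w\<^sup>2 \<le> (s * (L / ?r))\<^sup>2" .
  qed (use s0 in auto)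
  have w3: "n * w ^ 3 \<le> s * (sqrt (L ^ 3 / ?r) + L ^ 3 / ?r)"
  proof (cases "L \<le> s")
    case True
    have "(n * w ^ 3)\<^sup>2 = n\<^sup>2 * (w\<^sup>2) ^ 3" by (simp add: power_mult_distrib power_mult[symmetric])
    also have "\<dots> = L ^ 3 * s ^ 3 / n" using True s0 unfolding w2
      by (simp add: max_def power_mult_distrib power_divide power2_eq_square power3_eq_cube field_simps)
    also have "\<dots> = s\<^sup>2 * (L ^ 3 * s / n)" by (simp add: power2_eq_square power3_eq_cube)
    also have "\<dots> \<le> s\<^sup>2 * (L ^ 3 * ?r / n)"
      using s s0 by (intro mult_left_mono divide_right_mono) auto
    also have "L ^ 3 * ?r / n = L ^ 3 / ?r" using r s0 by (simp add: field_simps)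
    also have "s\<^sup>2 * (L ^ 3 / ?r) = (s * sqrt (L ^ 3 / ?r))\<^sup>2"
      using s0 by (simp add: power_mult_distrib)
    finally have sq: "(n * w ^ 3)\<^sup>2 \<le> (s * sqrt (L ^ 3 / ?r))\<^sup>2" .
    have "n * w ^ 3 \<le> s * sqrt (L ^ 3 / ?r)"
      by (rule power2_le_imp_le[OF sq]) (use s0 in simp)
    also have "\<dots> \<le> s * (sqrt (L ^ 3 / ?r) + L ^ 3 / ?r)"
      using s0 by (intro mult_left_mono) auto
    finally show ?thesis .
  next
    case False
    then have "w = sqrt ((L / ?r)\<^sup>2)" using r s0 unfolding w_def by (simp add: max_def power_divide power2_eq_square)
    then have w: "w = L / ?r" using s0 by simp
    have "n * w ^ 3 = (?r * ?r) * (L / ?r) ^ 3" using w r by simp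
    also have "\<dots> = L ^ 3 / ?r" using s0 by (simp add: power3_eq_cube field_simps)
    also have "\<dots> \<le> sqrt (L ^ 3 / ?r) + L ^ 3 / ?r" using s0 by simp
    also have "\<dots> \<le> s * (sqrt (L ^ 3 / ?r) + L ^ 3 / ?r)"
      using mult_right_mono[of 1 s "sqrt (L ^ 3 / ?r) + L ^ 3 / ?r"] s s0 by simp
    finally show ?thesis .
  qed
  have "n1 * w \<le> n1 * (s * (L / ?r))" "n2 * w\<^sup>2 \<le> n2 * (s * (L\<^sup>2 / n))"
    using mult_left_mono[OF ws n12(1)] mult_left_mono[OF w2s n12(2)] by blast+
  then show "n1 * w + n2 * w\<^sup>2 + n * w ^ 3 \<le> error_term n n1 n2 L * s"
    using w3 unfolding error_term_def by (simp add: algebra_simps)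
qed

text \<open>Each permutation costs \<open>exp 3 ^ a\<close> times a product of vertex weights;
  summing these products gives \<open>(exp 1 / c) ^ c * B ^ a\<close>, where
  \<open>B \<le> \<eta> * s\<close>.\<close>

lemma sum_automorphic_le:
  fixes L :: real
  assumes pos: "\<And>i. i \<in> {1..n} \<Longrightarrow> d i \<ge> 1" and L: "L \<ge> 1"
    and sup: "\<And>F. finite F \<Longrightarrow> card (containing n d F) \<le> (L / n) ^ card F * card (graphs_with_degrees n d)"
    and e: "error_term n (num_degree n d 1) (num_degree n d 2) L \<le> 1"
    and p: "prime p" and c: "c > 0" "p * c \<le> n"
  shows "(\<Sum>\<pi>\<in>prime_order_perms {1..n} p c. real (card {G \<in> graphs_with_degrees n d. \<pi> \<in> automorphisms {1..n} G}))
    \<le> (exp 4 * error_term n (num_degree n d 1) (num_degree n d 2) L) ^ (p * c)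
      * card (graphs_with_degrees n d)"
proof -
  define \<eta> where "\<eta> = error_term n (num_degree n d 1) (num_degree n d 2) L"
  define a where "a = p * c"
  define s where "s = root p (real a)"
  define Z where "Z = max s L"
  define w where "w = sqrt (L / n * Z)"
  define B where "B = (\<Sum>v\<in>{1..n}. w ^ min 3 (d v))"
  let ?g = "card (graphs_with_degrees n d)"
  have p2: "p \<ge> 2" using p prime_ge_2_nat by auto
  have a: "a \<ge> 1" "a \<le> n" using c p2 by (auto simp: a_def)
  then have n: "n \<ge> 1" by simp
  have sp: "s ^ p = a" unfolding s_def using p2 by simp
  have s: "1 \<le> s" "s \<le> sqrt n"
  proof -
    show "1 \<le> s" unfolding s_def using a p2 by simp
    \<comment> \<open>\<open>p \<ge> 2\<close> enters here: the \<open>p\<close>-th root is at most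
      the square root.\<close>
    have "s \<le> root 2 a" unfolding s_def using a p2 by (intro real_root_decreasing) auto
    also have "\<dots> \<le> sqrt n" using a by (simp add: sqrt_def)
    finally show "s \<le> sqrt n" .
  qed
  note W = weight_bounds[of n "num_degree n d 1" "num_degree n d 2" L s, folded Z_def, folded w_def]
  have w: "w > 0" "w \<le> 1" using W n L s e by auto
  have BW: "B \<le> \<eta> * s"
  proof -
    have "B \<le> num_degree n d 1 * w + num_degree n d 2 * w\<^sup>2 + n * w ^ 3"
      unfolding B_def using pos w by (intro sum_weights_by_degree) auto
    also have "\<dots> \<le> \<eta> * s" unfolding \<eta>_def using W(3) n L s e by simp
    finally show ?thesis .
  qed
  have B0: "B \<ge> 0" unfolding B_def using w by (intro sum_nonneg) auto
  have Z1: "Z \<ge> 1" "Z \<ge> s" "Z \<ge> L" using s by (auto simp: Z_def)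
  \<comment> \<open>The three conditions on the weight thus become \<open>1 \<le> Z\<close>,
    \<open>a \<le> Z ^ p\<close> and \<open>L \<le> Z\<close>, which is why \<open>Z\<close> is the
    maximum of \<open>s\<close> and \<open>L\<close>.\<close>
  have qz: "L / n * (1 / w)\<^sup>2 = 1 / Z"
    unfolding w_def using L n Z1 by (simp add: power_divide real_sqrt_pow2)
  have each: "real (card {G \<in> graphs_with_degrees n d. \<pi> \<in> automorphisms {1..n} G})
      \<le> exp 3 ^ a * ?g * (\<Prod>v | \<pi> v \<noteq> v. w ^ min 3 (d v))"
    if \<pi>: "\<pi> \<in> prime_order_perms {1..n} p c" for \<pi>
  proof -
    let ?A = "{v. \<pi> v \<noteq> v}" and ?S = "{G \<in> graphs_with_degrees n d. \<pi> \<in> automorphisms {1..n} G}"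
    have \<pi>D: "\<pi> permutes {1..n}" "\<pi> ^^ p = id" "card ?A = a"
      using \<pi> by (auto simp: prime_order_perms_def a_def)
    have "card ?S * (\<Prod>v\<in>?A. (1 / w) ^ min 3 (d v)) \<le> exp 3 ^ card ?A * ?g"
    proof (rule card_automorphic_le[OF \<pi>D(1) p \<pi>D(2) refl, of "1 / w" "L / n"])
      show "1 / w \<ge> 1" using w by simp
      show "L / n \<ge> 0" using L by simp
      show "L / n * (1 / w)\<^sup>2 \<le> 1" unfolding qz using Z1 by simp
      have "a \<le> Z ^ p" using power_mono[OF Z1(2), of p] s sp by simp
      then show "card ?A * (L / n * (1 / w)\<^sup>2) ^ p \<le> 1"
        unfolding qz \<pi>D(3) using Z1 by (simp add: power_divide divide_le_eq)
      show "n * (L / n * (L / n * (1 / w)\<^sup>2)) \<le> 1"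
        unfolding qz using Z1 n by (simp add: divide_le_eq)
      show "card (containing n d F) \<le> (L / n) ^ card F * ?g" if "finite F" for F
        using sup[OF that] .
    qed
    moreover have "(\<Prod>v\<in>?A. (1 / w) ^ min 3 (d v)) = 1 / (\<Prod>v\<in>?A. w ^ min 3 (d v))"
      by (simp add: power_divide prod_dividef)
    moreover have "(\<Prod>v\<in>?A. w ^ min 3 (d v)) > 0" using w by (intro prod_pos) auto
    ultimately show ?thesis by (simp add: \<pi>D(3) divide_le_eq)
  qed
  have "(\<Sum>\<pi>\<in>prime_order_perms {1..n} p c. real (card {G \<in> graphs_with_degrees n d. \<pi> \<in> automorphisms {1..n} G}))
      \<le> (\<Sum>\<pi>\<in>prime_order_perms {1..n} p c. exp 3 ^ a * ?g * (\<Prod>v | \<pi> v \<noteq> v. w ^ min 3 (d v)))"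
    using each by (rule sum_mono)
  also have "\<dots> = exp 3 ^ a * ?g * (\<Sum>\<pi>\<in>prime_order_perms {1..n} p c. \<Prod>v | \<pi> v \<noteq> v. w ^ min 3 (d v))"
    by (simp add: sum_distrib_left)
  also have "\<dots> \<le> exp 3 ^ a * ?g * ((exp 1 * B / c) ^ c * B ^ (c * (p - 1)))"
    unfolding B_def using w p c by (intro mult_left_mono sum_prime_order_perms_le) auto
  also have "(exp 1 * B / c) ^ c * B ^ (c * (p - 1)) = (exp 1 / c) ^ c * B ^ a"
  proof -
    have "a = c + c * (p - 1)" using p2 by (simp add: a_def algebra_simps)
    then show ?thesis by (simp add: power_add power_mult_distrib power_divide)
  qed
  also have "exp 3 ^ a * ?g * ((exp 1 / c) ^ c * B ^ a)
      \<le> exp 3 ^ a * ?g * ((exp 1 / c) ^ c * (\<eta> * s) ^ a)"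
    using BW B0 by (intro mult_left_mono power_mono) auto
  also have "(exp 1 / c) ^ c * (\<eta> * s) ^ a = \<eta> ^ a * (exp 1 * p) ^ c"
  proof -
    \<comment> \<open>The factor \<open>c ^ c\<close> in this power cancels the denominator gained
      from the unordered minima.\<close>
    have "s ^ a = (real p * c) ^ c" unfolding a_def power_mult sp by (simp add: a_def)
    then show ?thesis using c by (simp add: power_mult_distrib power_divide)
  qed
  also have "exp 3 ^ a * ?g * (\<eta> ^ a * (exp 1 * p) ^ c) \<le> exp 3 ^ a * ?g * (\<eta> ^ a * exp 1 ^ a)"
  proof -
    \<comment> \<open>This turns \<open>(exp 1 * p) ^ c\<close> into at most
      \<open>exp 1 ^ a\<close>, raising the constant from \<open>exp 3\<close> to
      \<open>exp 4\<close>.\<close>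
    have "real p \<le> exp (real p - 1)" using exp_ge_add_one_self[of "real p - 1"] by simp
    then have "exp 1 * real p \<le> exp 1 * exp (real p - 1)" by simp
    also have "\<dots> = exp 1 ^ p" by (simp add: exp_add[symmetric] exp_of_nat_mult[symmetric])
    finally have "(exp 1 * real p) ^ c \<le> (exp 1 ^ p) ^ c" by (intro power_mono) auto
    moreover have "\<eta> \<ge> 0" unfolding \<eta>_def error_term_def using L by simp
    ultimately show ?thesis by (intro mult_left_mono) (auto simp: a_def power_mult)
  qed
  also have "\<dots> = (exp 4 * \<eta>) ^ a * ?g"
  proof -
    have "exp (4 :: real) = exp 3 * exp 1" by (simp add: exp_add[symmetric])
    then show ?thesis by (simp add: power_mult_distrib)
  qed
  finally show ?thesis by (simp add: \<eta>_def a_def)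
qed

lemma sum_geometric_le:
  fixes y :: real
  assumes "0 \<le> y" "y \<le> 1 / 2"
  shows "(\<Sum>i<k. y ^ i) \<le> 2"
proof -
  have "(\<Sum>i<k. y ^ i) \<le> (\<Sum>i<k. (1 / 2) ^ i)" using assms by (intro sum_mono power_mono) auto
  also have "\<dots> \<le> 2" by (simp add: geometric_sum)
  finally show ?thesis .
qed

text \<open>Union bound over \<open>p\<close> and \<open>c\<close>. Splitting
  \<open>y ^ (p * c)\<close> into \<open>y ^ (p - 1) * y ^ c\<close> leaves two geometric sums,
  bounded by 2 and \<open>2 * y\<close>.\<close>

lemma card_not_asymmetric_le:
  fixes L y :: real
  assumes pos: "\<And>i. i \<in> {1..n} \<Longrightarrow> d i \<ge> 1" and L: "L \<ge> 1"
    and sup: "\<And>F. finite F \<Longrightarrow> card (containing n d F) \<le> (L / n) ^ card F * card (graphs_with_degrees n d)"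
  defines "y \<equiv> exp 4 * error_term n (num_degree n d 1) (num_degree n d 2) L"
  assumes y: "y \<le> 1 / 2"
  shows "card {G \<in> graphs_with_degrees n d. \<not> asymmetric {1..n} G}
    \<le> 4 * y * card (graphs_with_degrees n d)"
proof -
  let ?g = "card (graphs_with_degrees n d)"
  let ?P = "{p. prime p \<and> p \<le> n}"
  let ?S = "\<lambda>\<pi>. {G \<in> graphs_with_degrees n d. \<pi> \<in> automorphisms {1..n} G}"
  define \<eta> where "\<eta> = error_term n (num_degree n d 1) (num_degree n d 2) L"
  have \<eta>0: "\<eta> \<ge> 0" unfolding \<eta>_def error_term_def using L by simp
  then have y0: "y \<ge> 0" by (simp add: y_def \<eta>_def)
  have "1 * \<eta> \<le> exp 4 * \<eta>" using \<eta>0 by (intro mult_right_mono) auto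
  then have \<eta>1: "\<eta> \<le> 1" using y by (simp add: y_def \<eta>_def)
  have finP: "finite ?P" by simp
  have finS: "finite (?S \<pi>)" for \<pi> using finite_graphs_with_degrees by simp
  have fins: "finite (\<Union>\<pi>\<in>prime_order_perms {1..n} p c. ?S \<pi>)" for p c
    using finS finite_prime_order_perms by (intro finite_UN_I) auto
  have "card {G \<in> graphs_with_degrees n d. \<not> asymmetric {1..n} G}
      \<le> card (\<Union>p\<in>?P. \<Union>c\<in>{1..n div p}. \<Union>\<pi>\<in>prime_order_perms {1..n} p c. ?S \<pi>)"
    by (intro card_mono not_asymmetric_subset finite_UN_I finP fins finite_atLeastAtMost)
  also have "\<dots> \<le> (\<Sum>p\<in>?P. card (\<Union>c\<in>{1..n div p}. \<Union>\<pi>\<in>prime_order_perms {1..n} p c. ?S \<pi>))"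
    by (rule card_UN_le[OF finP])
  also have "\<dots> \<le> (\<Sum>p\<in>?P. \<Sum>c\<in>{1..n div p}. card (\<Union>\<pi>\<in>prime_order_perms {1..n} p c. ?S \<pi>))"
    by (intro sum_mono card_UN_le) auto
  also have "\<dots> \<le> (\<Sum>p\<in>?P. \<Sum>c\<in>{1..n div p}. \<Sum>\<pi>\<in>prime_order_perms {1..n} p c. card (?S \<pi>))"
    by (intro sum_mono card_UN_le finite_prime_order_perms) auto
  finally have "real (card {G \<in> graphs_with_degrees n d. \<not> asymmetric {1..n} G})
      \<le> real (\<Sum>p\<in>?P. \<Sum>c\<in>{1..n div p}. \<Sum>\<pi>\<in>prime_order_perms {1..n} p c. card (?S \<pi>))"
    by (simp only: of_nat_le_iff)
  also have "\<dots> = (\<Sum>p\<in>?P. \<Sum>c\<in>{1..n div p}. \<Sum>\<pi>\<in>prime_order_perms {1..n} p c. real (card (?S \<pi>)))"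
    by simp
  also have "\<dots> \<le> (\<Sum>p\<in>?P. \<Sum>c\<in>{1..n div p}. y ^ (p - 1) * y ^ c * ?g)"
  proof (intro sum_mono)
    fix p c assume p: "p \<in> ?P" and c: "c \<in> {1..n div p}"
    have p2: "p \<ge> 2" using p prime_ge_2_nat by auto
    have pc: "p * c \<le> n" using c p2 by (simp add: less_eq_div_iff_mult_less_eq mult.commute)
    have "(\<Sum>\<pi>\<in>prime_order_perms {1..n} p c. real (card (?S \<pi>))) \<le> y ^ (p * c) * ?g"
      unfolding y_def using p c pc \<eta>1 unfolding \<eta>_def
      by (intro sum_automorphic_le pos L sup) auto
    also have "\<dots> \<le> y ^ (p - 1 + c) * ?g"
    proof -
      obtain i j where "p = Suc i" "c = Suc j" using p2 c by (cases p; cases c) auto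
      \<comment> \<open>The difference of the two sides is \<open>(p - 1) * (c - 1)\<close>.\<close>
      then have "p - 1 + c \<le> p * c" by simp
      then show ?thesis using y y0 by (intro mult_right_mono power_decreasing) auto
    qed
    finally show "(\<Sum>\<pi>\<in>prime_order_perms {1..n} p c. real (card (?S \<pi>))) \<le> y ^ (p - 1) * y ^ c * ?g"
      by (simp add: power_add)
  qed
  also have "\<dots> \<le> (\<Sum>p\<in>{1..n}. \<Sum>c\<in>{1..n}. y ^ (p - 1) * y ^ c * ?g)"
  proof -
    have "(\<Sum>c\<in>{1..n div p}. y ^ (p - 1) * y ^ c * ?g) \<le> (\<Sum>c\<in>{1..n}. y ^ (p - 1) * y ^ c * ?g)" for p
      using y0 by (intro sum_mono2) (auto intro: order_trans[OF _ div_le_dividend])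
    then have "(\<Sum>p\<in>?P. \<Sum>c\<in>{1..n div p}. y ^ (p - 1) * y ^ c * ?g)
        \<le> (\<Sum>p\<in>?P. \<Sum>c\<in>{1..n}. y ^ (p - 1) * y ^ c * ?g)" by (intro sum_mono)
    also have "\<dots> \<le> (\<Sum>p\<in>{1..n}. \<Sum>c\<in>{1..n}. y ^ (p - 1) * y ^ c * ?g)"
      using y0 by (intro sum_mono2) (auto intro!: sum_nonneg dest: prime_gt_0_nat)
    finally show ?thesis .
  qed
  also have "\<dots> = (\<Sum>p\<in>{1..n}. y ^ (p - 1)) * (\<Sum>c\<in>{1..n}. y ^ c) * ?g"
    unfolding sum_product by (simp only: sum_distrib_right)
  also have "\<dots> \<le> 2 * (2 * y) * ?g"
  proof (rule mult_right_mono)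
    have "(\<Sum>p\<in>{1..n}. y ^ (p - 1)) = (\<Sum>i<n. y ^ i)"
      by (simp add: sum.atLeast1_atMost_eq)
    moreover have "(\<Sum>c\<in>{1..n}. y ^ c) = (\<Sum>i<n. y ^ i) * y"
      by (simp add: sum.atLeast1_atMost_eq sum_distrib_left mult.commute)
    moreover have "(\<Sum>i<n. y ^ i) * y \<le> 2 * y"
      using sum_geometric_le[OF y0 y] y0 by (rule mult_right_mono)
    moreover have "0 \<le> (\<Sum>i<n. y ^ i) * y" using y0 by (simp add: sum_nonneg)
    ultimately show "(\<Sum>p\<in>{1..n}. y ^ (p - 1)) * (\<Sum>c\<in>{1..n}. y ^ c) \<le> 2 * (2 * y)"
      using mult_mono[OF sum_geometric_le[OF y0 y, of n], of "(\<Sum>i<n. y ^ i) * y" "2 * y"] by simp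
  qed simp
  finally show ?thesis by simp
qed

lemma prob_asymmetric_ge:
  fixes L y :: real
  assumes seq: "degree_sequence n d" and n: "n \<ge> 1" and pos: "\<And>i. i \<in> {1..n} \<Longrightarrow> d i \<ge> 1"
  defines "L \<equiv> 12 * exp 1 * degree_ratio n d"
  defines "y \<equiv> exp 4 * error_term n (num_degree n d 1) (num_degree n d 2) L"
  assumes L: "L \<ge> 1" and y: "y \<le> 1 / 2"
  shows "measure_pmf.prob (random_graph n d) {G. asymmetric {1..n} G} \<ge> 1 - 4 * y"
proof -
  let ?\<G> = "graphs_with_degrees n d"
  have ne: "?\<G> \<noteq> {}" using seq by (simp add: degree_sequence_def graphical_def)
  have g: "real (card ?\<G>) > 0" using ne finite_graphs_with_degrees by (simp add: card_gt_0_iff)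
  have sup: "card (containing n d F) \<le> (L / n) ^ card F * card ?\<G>" if "finite F" for F
  proof -
    have "L / n = 12 * exp 1 * (real (max_degree n d))\<^sup>2 / real (degree_sum n d)"
      using n by (simp add: L_def degree_ratio_def avg_degree_def)
    then show ?thesis using card_containing_le[of n d F] seq that by (simp add: degree_sequence_def)
  qed
  have bad: "card {G \<in> ?\<G>. \<not> asymmetric {1..n} G} \<le> 4 * y * card ?\<G>"
    unfolding y_def using card_not_asymmetric_le[of n d L] pos L sup y by (simp add: y_def)
  have "card ?\<G> = card (?\<G> \<inter> {G. asymmetric {1..n} G}) + card {G \<in> ?\<G>. \<not> asymmetric {1..n} G}"
    using finite_graphs_with_degrees[of n d]
    by (subst card_Un_disjoint[symmetric]) (auto intro: arg_cong[where f = card])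
  then have "real (card ?\<G>) - 4 * y * card ?\<G> \<le> card (?\<G> \<inter> {G. asymmetric {1..n} G})"
    using bad by linarith
  then have "(1 - 4 * y) * card ?\<G> \<le> card (?\<G> \<inter> {G. asymmetric {1..n} G})"
    by (simp add: algebra_simps)
  then show ?thesis
    unfolding random_graph_def measure_pmf_of_set[OF ne finite_graphs_with_degrees]
    using g by (simp add: le_divide_eq)
qed

section \<open>From the growth conditions to a vanishing error\<close>

text \<open>The average degree is positive and at most \<Delta>, and \<Delta> is at most its square.
  This later ensures \<open>L \<ge> 1\<close>.\<close>

lemma degree_ratio_ge_1:
  assumes n: "n \<ge> 1" and pos: "\<And>i. i \<in> {1..n} \<Longrightarrow> d i \<ge> 1"
  shows "degree_ratio n d \<ge> 1"
proof -
  let ?D = "max_degree n d"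
  have dD: "d i \<le> ?D" if "i \<in> {1..n}" for i
    unfolding max_degree_def using that by (intro Max_ge) auto
  have D1: "?D \<ge> 1" using dD[of 1] pos[of 1] n by simp
  have "degree_sum n d \<le> n * ?D"
    unfolding degree_sum_def using sum_bounded_above[of "{1..n}" d ?D] dD by simp
  also have "\<dots> \<le> n * ?D\<^sup>2" using D1 by (intro mult_left_mono self_le_power) auto
  finally have le: "real (degree_sum n d) \<le> real n * (real ?D)\<^sup>2"
    by (metis of_nat_le_iff of_nat_mult of_nat_power)
  have "n * 1 \<le> degree_sum n d"
    unfolding degree_sum_def using sum_bounded_below[of "{1..n}" 1 d] pos by simp
  then have "real (degree_sum n d) > 0" using n by simp
  then show ?thesis
    using le n unfolding degree_ratio_def avg_degree_def by (simp add: field_simps)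
qed

lemma num_degree_le: "num_degree n d j \<le> n"
proof -
  have "card {i \<in> {1..n}. d i = j} \<le> card {1..n}" by (intro card_mono) auto
  then show ?thesis by (simp add: num_degree_def)
qed

text \<open>Rewrites the square of the second growth ratio. For \<open>m = 0\<close> both sides are
  0 by the convention for division by zero.\<close>

lemma ratio_squared_powr:
  fixes n m \<rho> :: real
  assumes "n > 0" "m \<ge> 0"
  shows "(\<rho> / (n powr (1 / 4) / m powr (1 / 2)))\<^sup>2 = m * \<rho>\<^sup>2 / sqrt n"
  using assms by (simp add: power_divide power_mult_distrib powr_power powr_half_sqrt)

text \<open>An exponent of at most 1/6 has a cube of at most \<open>sqrt n\<close>.\<close>

lemma ratio_cubed_le:
  fixes n \<rho> e :: real
  assumes "n \<ge> 1" "\<rho> \<ge> 0" "e \<le> 1 / 6"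
  shows "\<rho> ^ 3 / sqrt n \<le> (\<rho> / n powr e) ^ 3"
proof -
  have "(n powr e) ^ 3 \<le> (n powr (1 / 6)) ^ 3" using assms by (intro power_mono powr_mono) auto
  also have "\<dots> = sqrt n" using assms by (simp add: powr_power powr_half_sqrt)
  finally show ?thesis
    using assms unfolding power_divide by (intro divide_left_mono) auto
qed

text \<open>As \<open>m / n \<le> 1\<close>, lowering the exponent from 1/2 to
  \<open>\<beta>\<close> can only increase the power.\<close>

lemma ratio_squared_le:
  fixes n m \<rho> \<beta> :: real
  assumes "n > 0" "0 \<le> m" "m \<le> n" "\<rho> \<ge> 0" "\<beta> \<le> 1 / 2"
  shows "m * \<rho>\<^sup>2 / n \<le> (\<rho> / (n powr \<beta> / m powr \<beta>))\<^sup>2"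
proof -
  have "m * \<rho>\<^sup>2 / n = ((m / n) powr (1 / 2) * \<rho>)\<^sup>2"
    using assms by (simp add: power_mult_distrib powr_half_sqrt)
  also have "\<dots> \<le> ((m / n) powr \<beta> * \<rho>)\<^sup>2"
    using assms by (intro power_mono mult_right_mono powr_mono') auto
  also have "(m / n) powr \<beta> * \<rho> = \<rho> / (n powr \<beta> / m powr \<beta>)"
    using assms by (simp add: powr_divide)
  finally show ?thesis .
qed

theorem theorem1p3:
  fixes n :: "nat \<Rightarrow> nat" and d :: "nat \<Rightarrow> nat \<Rightarrow> nat"
    and R\<^sub>1 R\<^sub>2 \<epsilon> :: real and \<alpha> :: "nat \<Rightarrow> real"
  assumes n_lim: "filterlim n at_top sequentially"
    and deg_seq: "\<And>k. degree_sequence (n k) (d k)"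
    and deg_pos: "\<And>k i. i \<in> {1..n k} \<Longrightarrow> d k i \<ge> 1"
    and params: "R\<^sub>1 > 0" "R\<^sub>2 > 0" "0 < \<epsilon>" "\<epsilon> < 1"
    and alpha2: "\<alpha> 2 = 1 / (R\<^sub>2 + 4)"
    and alpha1: "\<alpha> 1 = (1 - \<alpha> 2) / (R\<^sub>1 + 4)"
    and cond1: "little_o (\<lambda>k. degree_ratio (n k) (d k))
                  (\<lambda>k. real (n k) powr (1 / 6 - 1 / (2 * R\<^sub>1) - 1 / R\<^sub>2))"
    and cond2: "little_o (\<lambda>k. degree_ratio (n k) (d k))
                  (\<lambda>k. real (n k) powr (1 / 4) / real (num_degree (n k) (d k) 1) powr (1 / 2))"
    and cond3: "little_o (\<lambda>k. degree_ratio (n k) (d k))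
                  (\<lambda>k. real (n k) powr (\<alpha> 2 / 2) / real (num_degree (n k) (d k) 2) powr (\<alpha> 2 / 2))"
    and cond4: "\<And>i. i \<in> {1, 2} \<Longrightarrow>
                  little_o (\<lambda>k. (real (num_degree (n k) (d k) i) / real (n k)) powr (\<alpha> i * (1 - \<epsilon>))
                                 * degree_ratio (n k) (d k) powr (2 - \<epsilon>))
                    (\<lambda>k. 1)"
  shows "(\<lambda>k. measure_pmf.prob (random_graph (n k) (d k)) {G. asymmetric {1..n k} G}) \<longlonglongrightarrow> 1"
proof -
  define C where "C = 12 * exp (1 :: real)"
  define \<rho> where "\<rho> k = degree_ratio (n k) (d k)" for k
  define n1 where "n1 k = real (num_degree (n k) (d k) 1)" for k
  define n2 where "n2 k = real (num_degree (n k) (d k) 2)" for k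
  define y where "y k = exp 4 * error_term (n k) (n1 k) (n2 k) (C * \<rho> k)" for k
  have C1: "C \<ge> 1"
    unfolding C_def using mult_mono[of 1 12 1 "exp (1 :: real)"] by simp
  have ev: "\<forall>\<^sub>F k in sequentially. n k \<ge> 1"
    using n_lim by (simp add: filterlim_at_top)
  have \<rho>1: "\<rho> k \<ge> 1" if "n k \<ge> 1" for k
    unfolding \<rho>_def using that deg_pos by (rule degree_ratio_ge_1)

  \<comment> \<open>Squaring the second condition controls
    \<open>n1 * \<rho>\<^sup>2 / sqrt n\<close>, which dominates since
    \<open>\<rho> \<ge> 1\<close>.\<close>
  have l1: "(\<lambda>k. n1 k * \<rho> k / sqrt (n k)) \<longlonglongrightarrow> 0"
  proof (rule tendsto_sandwich[OF _ _ tendsto_const])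
    show "\<forall>\<^sub>F k in sequentially. 0 \<le> n1 k * \<rho> k / sqrt (n k)"
      using ev by eventually_elim (use \<rho>1 in \<open>force simp: n1_def\<close>)
    show "\<forall>\<^sub>F k in sequentially. n1 k * \<rho> k / sqrt (n k) \<le> (\<rho> k / (n k powr (1 / 4) / n1 k powr (1 / 2)))\<^sup>2"
      using ev
    proof eventually_elim
      case (elim k)
      have "\<rho> k \<le> (\<rho> k)\<^sup>2" using \<rho>1[OF elim] by (simp add: self_le_power)
      then have "n1 k * \<rho> k / sqrt (n k) \<le> n1 k * (\<rho> k)\<^sup>2 / sqrt (n k)"
        by (intro divide_right_mono mult_left_mono) (auto simp: n1_def)
      then show ?case using elim by (subst ratio_squared_powr) (auto simp: n1_def)
    qed
    show "(\<lambda>k. (\<rho> k / (n k powr (1 / 4) / n1 k powr (1 / 2)))\<^sup>2) \<longlonglongrightarrow> 0"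
      using tendsto_power[OF cond2[unfolded little_o_def], of 2] by (simp add: \<rho>_def n1_def)
  qed
  have l2: "(\<lambda>k. n2 k * (\<rho> k)\<^sup>2 / n k) \<longlonglongrightarrow> 0"
  proof (rule tendsto_sandwich[OF _ _ tendsto_const])
    show "\<forall>\<^sub>F k in sequentially. 0 \<le> n2 k * (\<rho> k)\<^sup>2 / n k"
      by (simp add: n2_def)
    \<comment> \<open>\<open>R\<^sub>2 > 0\<close> gives \<open>\<alpha> 2 \<le> 1\<close>, as the
      comparison of exponents requires.\<close>
    have "\<alpha> 2 / 2 \<le> 1 / 2" using params by (simp add: alpha2)
    then show "\<forall>\<^sub>F k in sequentially. n2 k * (\<rho> k)\<^sup>2 / n k
        \<le> (\<rho> k / (n k powr (\<alpha> 2 / 2) / n2 k powr (\<alpha> 2 / 2)))\<^sup>2"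
      using ev
      by (elim eventually_mono, intro ratio_squared_le)
        (use \<rho>1 num_degree_le in \<open>force simp: n2_def\<close>)+
    show "(\<lambda>k. (\<rho> k / (n k powr (\<alpha> 2 / 2) / n2 k powr (\<alpha> 2 / 2)))\<^sup>2) \<longlonglongrightarrow> 0"
      using tendsto_power[OF cond3[unfolded little_o_def], of 2] by (simp add: \<rho>_def n2_def)
  qed
  have l3: "(\<lambda>k. \<rho> k ^ 3 / sqrt (n k)) \<longlonglongrightarrow> 0"
  proof (rule tendsto_sandwich[OF _ _ tendsto_const])
    let ?e = "1 / 6 - 1 / (2 * R\<^sub>1) - 1 / R\<^sub>2"
    show "\<forall>\<^sub>F k in sequentially. 0 \<le> \<rho> k ^ 3 / sqrt (n k)"
      using ev by eventually_elim (use \<rho>1 in force)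
    \<comment> \<open>The subtracted terms are nonnegative, so the exponent in the first condition
      is at most 1/6.\<close>
    have "1 / (2 * R\<^sub>1) \<ge> 0" "1 / R\<^sub>2 \<ge> 0" using params by simp_all
    then have "?e \<le> 1 / 6" by linarith
    then show "\<forall>\<^sub>F k in sequentially. \<rho> k ^ 3 / sqrt (n k) \<le> (\<rho> k / n k powr ?e) ^ 3"
      using ev by (elim eventually_mono, intro ratio_cubed_le) (use \<rho>1 in force)+
    show "(\<lambda>k. (\<rho> k / n k powr ?e) ^ 3) \<longlonglongrightarrow> 0"
      using tendsto_power[OF cond1[unfolded little_o_def], of 3] by (simp add: \<rho>_def)
  qed
  \<comment> \<open>The constant \<open>C\<close> is pulled out of the four summands, leaving the
    three sequences just shown to vanish.\<close>
  have "y = (\<lambda>k. exp 4 * (C * (n1 k * \<rho> k / sqrt (n k)) + C\<^sup>2 * (n2 k * (\<rho> k)\<^sup>2 / n k)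
      + sqrt (C ^ 3 * (\<rho> k ^ 3 / sqrt (n k))) + C ^ 3 * (\<rho> k ^ 3 / sqrt (n k))))"
    unfolding y_def error_term_def by (simp add: power_mult_distrib mult_ac)
  also have "\<dots> \<longlonglongrightarrow> exp 4 * (C * 0 + C\<^sup>2 * 0 + sqrt (C ^ 3 * 0) + C ^ 3 * 0)"
    by (intro tendsto_intros l1 l2 l3)
  finally have y0: "y \<longlonglongrightarrow> 0" by simp
  show ?thesis
  proof (rule tendsto_sandwich[OF _ _ _ tendsto_const])
    have "\<forall>\<^sub>F k in sequentially. y k < 1 / 2"
      using y0 by (rule order_tendstoD) simp
    with ev show "\<forall>\<^sub>F k in sequentially. 1 - 4 * y k
        \<le> measure_pmf.prob (random_graph (n k) (d k)) {G. asymmetric {1..n k} G}"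
    proof eventually_elim
      case (elim k)
      have "C * \<rho> k \<ge> 1" using mult_mono[of 1 C 1 "\<rho> k"] C1 \<rho>1[OF elim(1)] by simp
      then show ?case
        using prob_asymmetric_ge[OF deg_seq elim(1) deg_pos] elim(2)
        by (simp add: y_def C_def \<rho>_def n1_def n2_def)
    qed
    show "\<forall>\<^sub>F k in sequentially.
        measure_pmf.prob (random_graph (n k) (d k)) {G. asymmetric {1..n k} G} \<le> 1"
      by (simp add: measure_pmf.prob_le_1)
    show "(\<lambda>k. 1 - 4 * y k) \<longlonglongrightarrow> 1"
      using tendsto_diff[OF tendsto_const tendsto_mult[OF tendsto_const y0], of 1 4] by simp
  qed
qed

end
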